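(* Let $\mathrm{pen}_D=0$. If $S$ is a $p\times p$ Gaussian sample covariance matrix with $m_0<p$ eigenvalues equal to $0$ and $$\liminf_{|x|\to\infty}\frac{\mathrm{pen}(x)}{\log|x|}>m_0,$$ then the penalised likelihood estimate $\hat\Theta_{\mathrm{Pen}}$ exists with probability $1$.
   Context: Fix an integer $p\ge 1$. All matrices are real symmetric $p\times p$; $\Theta=(\theta_{ij})\succ 0$ means $\Theta$ is positive definite. The off-diagonal penalty $\mathrm{pen}:\mathbb{R}\to\mathbb{R}$ is non-negative, symmetric around $0$, non-decreasing in $|x|$ and continuous, and $\mathrm{pen}_D:(0,\infty)\to\mathbb{R}$ denotes the diagonal penalty. Define $$\mathrm{Pen}(\Theta)=\sum_{i=1}^p \mathrm{pen}_D(\theta_{ii})+\sum_{i<j}\mathrm{pen}(\theta_{ij}),\qquad l_{\mathrm{Pen}}(\Theta\mid S)=\log\det\Theta-\mathrm{tr}(S\Theta)-\mathrm{Pen}(\Theta),\quad \Theta\succ 0.$$ The penalised likelihood estimate is $\hat\Theta_{\mathrm{Pen}}=\mathrm{argmax}_{\Theta\succ 0}\, l_{\mathrm{Pen}}(\Theta\mid S)$; it is said to exist if the supremum of $l_{\mathrm{Pen}}(\cdot\mid S)$ over positive definite $\Theta$ is finite and attained. A Gaussian sample covariance matrix is built from $X_1,\dots,X_n$ i.i.d. $N_p(\mu,\Theta_0^{-1})$ with $n\ge 1$ and $\Theta_0\succ 0$: it is $S=\frac1n\sum_{i=1}^n (X_i-\bar X)(X_i-\bar X)^\top$ with $\bar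 X=\frac1n\sum_i X_i$ when $\mu$ is unknown, or $S=\frac1n\sum_{i=1}^n (X_i-\mu)(X_i-\mu)^\top$ when $\mu$ is known. The number $m_0$ of eigenvalues of $S$ equal to $0$ is, with probability 1, the deterministic number $\max(p-n+1,0)$ in the unknown mean case and $\max(p-n,0)$ in the known mean case. *)

theory Defs
  imports
    "HOL-Probability.Probability"
    "HOL-Computational_Algebra.Polynomial"
begin

definition pos_def :: "real ^ 'p ^ 'p \<Rightarrow> bool" where
  "pos_def A \<longleftrightarrow> transpose A = A \<and> (\<forall>x. x \<noteq> 0 \<longrightarrow> x \<bullet> (A *v x) > 0)"

definition charpoly :: "real ^ 'p ^ 'p \<Rightarrow> real poly" where
  "charpoly A = det (mat [:0, 1:] - (\<chi> i j. [:A $ i $ j:]))"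

text \<open>Eigenvalues are counted with algebraic multiplicity; for a symmetric matrix this is the
  number of indices k with \<open>\<lambda>\<^sub>k = c\<close> in the list \<open>\<lambda>\<^sub>1, \<dots>, \<lambda>\<^sub>p\<close> of its eigenvalues.\<close>

definition eigenvalue_count :: "real ^ 'p ^ 'p \<Rightarrow> real \<Rightarrow> nat" where
  "eigenvalue_count A c = order c (charpoly A)"

text \<open>The linear order on the index type serves only to express the sum over \<open>i < j\<close>.
  Only the values of \<open>pen\<^sub>D\<close> on the positive reals matter, as the diagonal of a positive definite
  matrix is positive.\<close>

definition Pen ::
  "(real \<Rightarrow> real) \<Rightarrow> (real \<Rightarrow> real) \<Rightarrow>
     real ^ ('p::{finite,linorder}) ^ ('p::{finite,linorder}) \<Rightarrow> real" where
  "Pen pen\<^sub>D pen \<Theta> =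
     (\<Sum>i\<in>UNIV. pen\<^sub>D (\<Theta> $ i $ i)) + (\<Sum>(i, j)\<in>{(i, j). i < j}. pen (\<Theta> $ i $ j))"

definition l_Pen ::
  "(real \<Rightarrow> real) \<Rightarrow> (real \<Rightarrow> real) \<Rightarrow>
     real ^ ('p::{finite,linorder}) ^ ('p::{finite,linorder}) \<Rightarrow>
     real ^ ('p::{finite,linorder}) ^ ('p::{finite,linorder}) \<Rightarrow> real"
  where
  "l_Pen pen\<^sub>D pen S \<Theta> = ln (det \<Theta>) - trace (S ** \<Theta>) - Pen pen\<^sub>D pen \<Theta>"

definition penalised_estimate_exists ::
  "(real \<Rightarrow> real) \<Rightarrow> (real \<Rightarrow> real) \<Rightarrow>
     real ^ ('p::{finite,linorder}) ^ ('p::{finite,linorder}) \<Rightarrow> bool" where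
  "penalised_estimate_exists pen\<^sub>D pen S \<longleftrightarrow>
     bdd_above (l_Pen pen\<^sub>D pen S ` {\<Theta>. pos_def \<Theta>}) \<and>
     (\<exists>\<Theta>'. pos_def \<Theta>' \<and> l_Pen pen\<^sub>D pen S \<Theta>' = (SUP \<Theta>\<in>{\<Theta>. pos_def \<Theta>}. l_Pen pen\<^sub>D pen S \<Theta>))"

definition mvn_density :: "real ^ 'p \<Rightarrow> real ^ 'p ^ 'p \<Rightarrow> real ^ 'p \<Rightarrow> real" where
  "mvn_density \<mu> \<Sigma> x =
     exp (- ((x - \<mu>) \<bullet> (matrix_inv \<Sigma> *v (x - \<mu>))) / 2) / sqrt ((2 * pi) ^ CARD('p) * det \<Sigma>)"

definition iid_gaussian ::
  "'w measure \<Rightarrow> nat \<Rightarrow> (nat \<Rightarrow> 'w \<Rightarrow> real ^ 'p) \<Rightarrow> real ^ 'p \<Rightarrow> real ^ 'p ^ 'p \<Rightarrow> bool" where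
  "iid_gaussian M n X \<mu> \<Sigma> \<longleftrightarrow>
     prob_space.indep_vars M (\<lambda>_. borel) X {1..n} \<and>
     (\<forall>i\<in>{1..n}. distributed M lborel (X i) (\<lambda>x. ennreal (mvn_density \<mu> \<Sigma> x)))"

definition scatter_about :: "real ^ 'p \<Rightarrow> nat \<Rightarrow> (nat \<Rightarrow> real ^ 'p) \<Rightarrow> real ^ 'p ^ 'p" where
  "scatter_about c n x =
     (1 / real n) *\<^sub>R (\<Sum>k=1..n. \<chi> i j. (x k - c) $ i * (x k - c) $ j)"

definition sample_mean :: "nat \<Rightarrow> (nat \<Rightarrow> real ^ 'p) \<Rightarrow> real ^ 'p" where
  "sample_mean n x = (1 / real n) *\<^sub>R (\<Sum>k=1..n. x k)"

definition sample_cov_unknown_mean :: "nat \<Rightarrow> (nat \<Rightarrow> real ^ 'p) \<Rightarrow> real ^ 'p ^ 'p" where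
  "sample_cov_unknown_mean n x = scatter_about (sample_mean n x) n x"

definition sample_cov_known_mean :: "real ^ 'p \<Rightarrow> nat \<Rightarrow> (nat \<Rightarrow> real ^ 'p) \<Rightarrow> real ^ 'p ^ 'p" where
  "sample_cov_known_mean \<mu> n x = scatter_about \<mu> n x"

end

theory Submission imports Defs begin

text \<open>Let \<open>T = trace \<Theta>\<close>.  For positive definite \<open>B\<close> one has
  \<open>log det \<Theta> \<le> trace (B \<Theta>) - p - log det B\<close>.  Taking \<open>B = S + T\<^sup>-\<^sup>1 I\<close>, whose determinant is at least
  a constant times \<open>T\<close> to the power \<open>-m\<^sub>0\<close>, bounds \<open>log det \<Theta> - trace (S \<Theta>)\<close> by \<open>m\<^sub>0 log T\<close> up to a
  constant.  The penalty beats this whenever some off-diagonal entry of \<open>\<Theta>\<close> is comparable to \<open>T\<close>;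
  otherwise \<open>trace (S \<Theta>)\<close> itself grows linearly in \<open>T\<close>, because \<open>S\<close> has a positive diagonal.  So the
  superlevel sets of the objective are compact.  About \<open>S\<close> this uses only that it has a positive
  diagonal and exactly \<open>m\<^sub>0\<close> zero eigenvalues.  Both hold almost surely since finitely many
  independent vectors with densities, centred at a fixed point or at the first of them, are in
  general position.\<close>

subsection \<open>The spectral theorem for symmetric matrices\<close>

lemma symmetric_inner_matrix_vector:
  fixes A :: "real ^ 'n ^ 'n"
  assumes "transpose A = A"
  shows "x \<bullet> (A *v y) = (A *v x) \<bullet> y"
  by (metis assms dot_lmul_matrix vector_transpose_matrix)

text \<open>For small \<open>t\<close> with the sign of \<open>a\<close> the linear term would
  dominate. This serves as the first-order condition at a maximum of the Rayleigh quotient.\<close>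

lemma quadratic_nonpos_imp_linear_zero:
  fixes a b :: real
  assumes "\<And>t. 2 * t * a + t\<^sup>2 * b \<le> 0"
  shows "a = 0"
proof (rule ccontr)
  assume "a \<noteq> 0"
  \<comment> \<open>At \<open>t = s * a\<close> the expression equals
    \<open>s * a^2 * (2 + s * b)\<close>; \<open>s\<close> is small enough to keep the last factor
    positive.\<close>
  define s where "s = 1 / (1 + \<bar>b\<bar>)"
  have "s > 0" and "\<bar>s * b\<bar> < 1"
    by (auto simp: s_def abs_mult divide_simps)
  have "2 * (s * a) * a + (s * a)\<^sup>2 * b = s * a\<^sup>2 * (2 + s * b)"
    by (simp add: power2_eq_square algebra_simps)
  moreover have "s * a\<^sup>2 * (2 + s * b) > 0"
    using \<open>a \<noteq> 0\<close> \<open>s > 0\<close> \<open>\<bar>s * b\<bar> < 1\<close> by (intro mult_pos_pos) auto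
  ultimately show False
    using assms[of "s * a"] by simp
qed

text \<open>A unit vector maximising the Rayleigh quotient on the orthogonal complement of \<open>B\<close> is again
  an eigenvector.\<close>

lemma symmetric_eigenvector_orthogonal_to:
  fixes A :: "real ^ 'n ^ 'n"
  assumes sym: "transpose A = A"
    and eig: "\<And>b. b \<in> B \<Longrightarrow> \<exists>c. A *v b = c *\<^sub>R b"
    and dim: "dim B < CARD('n)"
  obtains v c where "norm v = 1" "\<And>b. b \<in> B \<Longrightarrow> orthogonal b v" "A *v v = c *\<^sub>R v"
proof -
  \<comment> \<open>The orthogonal complement of \<open>B\<close>, written as an intersection of
    hyperplanes so that it is visibly closed.\<close>
  define W where "W = (\<Inter>b\<in>B. {x. b \<bullet> x = 0})"
  obtain w where w: "w \<noteq> 0" "\<And>y. y \<in> span B \<Longrightarrow> orthogonal w y"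
    using orthogonal_to_subspace_exists[of B] dim by auto
  have "b \<bullet> w = 0" if "b \<in> B" for b
    using w(2)[OF span_base[OF that]] by (simp add: orthogonal_def inner_commute)
  then have "w /\<^sub>R norm w \<in> W \<inter> sphere 0 1"
    using w(1) by (auto simp: W_def)
  then have "W \<inter> sphere 0 1 \<noteq> {}"
    by blast
  moreover have "closed W"
    unfolding W_def by (intro closed_INT ballI closed_hyperplane)
  then have "compact (W \<inter> sphere 0 1)"
    by (simp add: closed_Int_compact)
  moreover have "continuous_on (W \<inter> sphere 0 1) (\<lambda>x. x \<bullet> (A *v x))"
    by (intro continuous_intros matrix_vector_mult_linear_continuous_on)
  ultimately obtain v where "v \<in> W \<inter> sphere 0 1"
    and "\<forall>x\<in>W \<inter> sphere 0 1. x \<bullet> (A *v x) \<le> v \<bullet> (A *v v)"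
    using continuous_attains_sup[of "W \<inter> sphere 0 1" "\<lambda>x. x \<bullet> (A *v x)"] by blast
  then have v: "v \<in> W" "norm v = 1"
    and max: "\<And>x. x \<in> W \<Longrightarrow> norm x = 1 \<Longrightarrow> x \<bullet> (A *v x) \<le> v \<bullet> (A *v v)"
    by auto
  define c where "c = v \<bullet> (A *v v)"
  \<comment> \<open>Homogeneity carries maximality from the unit sphere to all of
    \<open>W\<close>.\<close>
  have le: "x \<bullet> (A *v x) \<le> c * (x \<bullet> x)" if "x \<in> W" for x
  proof (cases "x = 0")
    case False
    have "x /\<^sub>R norm x \<in> W"
      using that by (auto simp: W_def)
    from max[OF this] False have "(x \<bullet> (A *v x)) / (norm x)\<^sup>2 \<le> c"
      by (simp add: c_def matrix_vector_mult_scaleR divide_inverse power2_eq_square mult_ac)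
    with False show ?thesis
      by (simp add: divide_le_eq power2_norm_eq_inner)
  qed auto
  \<comment> \<open>The residual of the eigenvector equation. It is orthogonal to \<open>v\<close>
    and lies in \<open>W\<close>, because every \<open>b\<close> is an eigenvector; so
    \<open>v\<close> may be varied in its direction.\<close>
  define u where "u = A *v v - c *\<^sub>R v"
  have "v \<bullet> v = 1"
    using v by (simp flip: power2_norm_eq_inner)
  have uv: "u \<bullet> v = 0"
    using \<open>v \<bullet> v = 1\<close> by (simp add: u_def inner_diff_left c_def inner_commute[of v "A *v v"])
  have "u \<in> W"
    unfolding W_def
  proof (intro INT_I CollectI)
    fix b assume "b \<in> B"
    with eig obtain d where "A *v b = d *\<^sub>R b" by blast
    moreover have "b \<bullet> v = 0"
      using v \<open>b \<in> B\<close> by (auto simp: W_def)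
    ultimately show "b \<bullet> u = 0"
      by (simp add: u_def inner_diff_right symmetric_inner_matrix_vector[OF sym])
  qed
  have Auv: "v \<bullet> (A *v u) = u \<bullet> u"
  proof -
    have "v \<bullet> (A *v u) = (u + c *\<^sub>R v) \<bullet> u"
      by (simp add: symmetric_inner_matrix_vector[OF sym] u_def)
    also have "\<dots> = u \<bullet> u"
      using uv by (simp add: inner_add_left inner_commute[of v u])
    finally show ?thesis .
  qed
  \<comment> \<open>Expand \<open>le\<close> at \<open>v + t u\<close>: the constant terms are
    \<open>c\<close> on both sides and cancel, and \<open>Auv\<close> turns the linear coefficient
    into \<open>2 * (u \<bullet> u)\<close>.\<close>
  have "2 * t * (u \<bullet> u) + t\<^sup>2 * (u \<bullet> (A *v u) - c * (u \<bullet> u)) \<le> 0" for t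
  proof -
    have "v + t *\<^sub>R u \<in> W"
      using v \<open>u \<in> W\<close> by (auto simp: W_def inner_add_right)
    from le[OF this] show ?thesis
      using uv Auv \<open>v \<bullet> v = 1\<close> c_def
      by (simp add: matrix_vector_right_distrib matrix_vector_mult_scaleR inner_add_left
          inner_add_right inner_commute symmetric_inner_matrix_vector[OF sym, of u v]
          power2_eq_square algebra_simps)
  qed
  then have "u \<bullet> u = 0"
    by (rule quadratic_nonpos_imp_linear_zero)
  then have "A *v v = c *\<^sub>R v"
    by (simp add: u_def)
  with v show thesis
    by (intro that[of v c]) (auto simp: W_def orthogonal_def)
qed

text \<open>Induction on the number of vectors: while it is below the dimension, the orthogonal
  complement supplies another eigenvector. The case \<open>k = CARD('n)\<close> yields an
  eigenbasis.\<close>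

lemma symmetric_orthonormal_eigenvectors:
  fixes A :: "real ^ 'n ^ 'n"
  assumes sym: "transpose A = A" and "k \<le> CARD('n)"
  shows "\<exists>B. finite B \<and> card B = k \<and> pairwise orthogonal B \<and>
           (\<forall>b\<in>B. norm b = 1 \<and> (\<exists>c. A *v b = c *\<^sub>R b))"
  using \<open>k \<le> CARD('n)\<close>
proof (induction k)
  case 0
  then show ?case by (intro exI[of _ "{}"]) auto
next
  case (Suc k)
  then obtain B where B: "finite B" "card B = k" "pairwise orthogonal B"
    "\<And>b. b \<in> B \<Longrightarrow> norm b = 1" "\<And>b. b \<in> B \<Longrightarrow> \<exists>c. A *v b = c *\<^sub>R b"
    by fastforce
  have "dim B < CARD('n)"
    using dim_le_card'[OF B(1)] B(2) Suc.prems by linarith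
  from symmetric_eigenvector_orthogonal_to[OF sym B(5) this] obtain v c where
    v: "norm v = 1" "\<And>b. b \<in> B \<Longrightarrow> orthogonal b v" "A *v v = c *\<^sub>R v" by blast
  have "v \<notin> B"
    using v by (metis norm_zero orthogonal_self zero_neq_one)
  with B v show ?case
    by (intro exI[of _ "insert v B"]) (auto simp: pairwise_insert orthogonal_commute)
qed

section \<open>Diagonal matrices and orthogonal diagonalisation\<close>

definition diag_mat :: "('n \<Rightarrow> 'a::zero) \<Rightarrow> 'a ^ 'n ^ 'n" where
  "diag_mat d = (\<chi> i j. if i = j then d i else 0)"

lemma diag_mat_nth [simp]: "diag_mat d $ i $ j = (if i = j then d i else 0)"
  by (simp add: diag_mat_def)

lemma diag_mat_mult_vec_nth: "(diag_mat d *v x) $ i = d i * (x $ i :: real)"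
  by (simp add: matrix_vector_mult_def if_distrib[of "\<lambda>y. y * _"] cong: if_cong)

lemma det_diag_mat: "det (diag_mat d :: real ^ 'n ^ 'n) = (\<Prod>i\<in>UNIV. d i)"
  by (subst det_diagonal) auto

lemma trace_diag_mat: "trace (diag_mat d :: real ^ 'n ^ 'n) = (\<Sum>i\<in>UNIV. d i)"
  by (simp add: trace_def)

text \<open>The orthonormal eigenvectors become the rows of \<open>Q\<close>, so
  \<open>A ** transpose Q = transpose Q ** diag_mat d\<close> holds column by column; multiplying by
  \<open>Q\<close> on the right finishes.\<close>

theorem symmetric_spectral_decomposition:
  fixes A :: "real ^ 'n ^ 'n"
  assumes sym: "transpose A = A"
  obtains Q d where "orthogonal_matrix Q" "A = transpose Q ** diag_mat d ** Q"
proof -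
  obtain B where B: "finite B" "card B = CARD('n)" "pairwise orthogonal B"
    "\<And>b. b \<in> B \<Longrightarrow> norm b = 1" "\<And>b. b \<in> B \<Longrightarrow> \<exists>c. A *v b = c *\<^sub>R b"
    using symmetric_orthonormal_eigenvectors[OF sym order_refl] by blast
  obtain f where f: "bij_betw f (UNIV :: 'n set) B"
    using B finite_same_card_bij[of "UNIV :: 'n set" B] by auto
  have fB: "f i \<in> B" for i
    using f by (auto simp: bij_betw_def)
  from B(5)[OF this] obtain d where d: "\<And>i. A *v f i = d i *\<^sub>R f i"
    by metis
  define Q where "Q = (\<chi> i. f i)"
  have orth: "orthogonal_matrix Q"
    unfolding orthogonal_matrix_orthonormal_rows
  proof safe
    fix i show "norm (row i Q) = 1"
      using B(4) fB by (simp add: Q_def row_def)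
  next
    fix i j :: 'n assume "i \<noteq> j"
    then have "f i \<noteq> f j"
      using f by (auto simp: bij_betw_def inj_on_def)
    then show "orthogonal (row i Q) (row j Q)"
      using B(3) fB by (auto simp: Q_def row_def pairwise_def)
  qed
  have "A ** transpose Q = transpose Q ** diag_mat d"
  proof -
    have "(A ** transpose Q) $ i $ j = (transpose Q ** diag_mat d) $ i $ j" for i j
    proof -
      have "(A ** transpose Q) $ i $ j = (A *v f j) $ i"
        by (simp add: matrix_matrix_mult_def matrix_vector_mult_def transpose_def Q_def)
      also have "\<dots> = (transpose Q ** diag_mat d) $ i $ j"
        by (simp add: d matrix_matrix_mult_def transpose_def Q_def
            if_distrib[of "\<lambda>y. _ * y"] cong: if_cong)
      finally show ?thesis .
    qed
    then show ?thesis by (simp add: vec_eq_iff)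
  qed
  then have "A ** (transpose Q ** Q) = transpose Q ** diag_mat d ** Q"
    by (simp add: matrix_mul_assoc)
  with orth that show thesis
    by (auto simp: orthogonal_matrix_def)
qed

subsection \<open>Zero eigenvalues and positive definite matrices\<close>

text \<open>Evaluation at \<open>x\<close> is a ring homomorphism. Identities for
  \<open>charpoly\<close> thereby reduce to identities of real determinants.\<close>

lemma poly_det: "poly (det M) x = det (\<chi> i j. poly (M $ i $ j) x)"
  for M :: "'a::comm_ring_1 poly ^ 'n ^ 'n"
  by (simp add: det_def poly_sum poly_prod)

lemma poly_charpoly: "poly (charpoly A) x = det (mat x - A)"
  unfolding charpoly_def poly_det by (rule arg_cong[of _ _ det]) (simp add: vec_eq_iff mat_def)

lemma det_orthogonal_conj:
  fixes M :: "real ^ 'n ^ 'n"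
  assumes "orthogonal_matrix Q"
  shows "det (transpose Q ** M ** Q) = det M"
  using det_orthogonal_matrix[OF assms] by (auto simp: det_mul)

lemma trace_orthogonal_conj:
  fixes M :: "real ^ 'n ^ 'n"
  assumes "orthogonal_matrix Q"
  shows "trace (transpose Q ** M ** Q) = trace M"
  using assms by (subst trace_mul_sym) (simp add: matrix_mul_assoc orthogonal_matrix_def)

lemma matrix_diff_ldistrib: "A ** (B - C) = A ** B - A ** C" for A :: "real ^ 'n ^ 'm"
  by (simp add: matrix_matrix_mult_def vec_eq_iff right_diff_distrib sum_subtractf)

lemma matrix_diff_rdistrib: "(B - C) ** A = B ** A - C ** A" for A :: "real ^ 'n ^ 'm"
  by (simp add: matrix_matrix_mult_def vec_eq_iff left_diff_distrib sum_subtractf)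

lemma matrix_add_rdistrib: "(B + C) ** A = B ** A + C ** A" for A :: "real ^ 'n ^ 'm"
  by (simp add: matrix_matrix_mult_def vec_eq_iff distrib_right sum.distrib)

lemma mat_eq_scaleR: "mat c = c *\<^sub>R (mat 1 :: real ^ 'n ^ 'n)"
  by (simp add: vec_eq_iff mat_def)

text \<open>Conjugation by \<open>Q\<close> fixes scalar matrices, so \<open>mat x\<close> minus the
  matrix is the conjugate of a diagonal matrix. Agreement at every real \<open>x\<close> gives
  equality of the polynomials.\<close>

lemma charpoly_orthogonal_diag:
  fixes Q :: "real ^ 'n ^ 'n"
  assumes Q: "orthogonal_matrix Q"
  shows "charpoly (transpose Q ** diag_mat d ** Q) = (\<Prod>i\<in>UNIV. [:- d i, 1:])"
proof (rule iffD1[OF poly_eq_poly_eq_iff], rule ext)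
  fix x
  have "transpose Q ** mat x ** Q = mat x"
  proof -
    have "transpose Q ** mat x ** Q = x *\<^sub>R (transpose Q ** Q)"
      by (simp add: mat_eq_scaleR[of x] matrix_scalar_ac scalar_matrix_assoc
          flip: scalar_mult_eq_scaleR)
    with Q show ?thesis
      by (simp add: orthogonal_matrix_def mat_eq_scaleR[of x])
  qed
  then have "mat x - transpose Q ** diag_mat d ** Q = transpose Q ** (mat x - diag_mat d) ** Q"
    by (simp add: matrix_diff_ldistrib matrix_diff_rdistrib)
  moreover have "mat x - diag_mat d = diag_mat (\<lambda>i. x - d i)"
    by (simp add: vec_eq_iff mat_def)
  ultimately show "poly (charpoly (transpose Q ** diag_mat d ** Q)) x = poly (\<Prod>i\<in>UNIV. [:- d i, 1:]) x"
    by (simp add: poly_charpoly det_orthogonal_conj[OF Q] det_diag_mat poly_prod)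
qed

text \<open>Orders add over products of nonzero polynomials, and a linear factor contributes 1
  exactly when its root is \<open>c\<close>.\<close>

lemma order_prod_linear:
  fixes d :: "'i \<Rightarrow> real"
  assumes "finite I"
  shows "order c (\<Prod>i\<in>I. [:- d i, 1:]) = card {i \<in> I. d i = c}"
  using assms
proof (induction I)
  case (insert i I)
  have nz: "(\<Prod>i\<in>I. [:- d i, 1:]) \<noteq> 0"
    using insert.hyps by simp
  have "order c [:- d i, 1:] = (if d i = c then 1 else 0)"
    using order_power_n_n[of c 1] by (auto simp: order_0I)
  moreover have "{j \<in> insert i I. d j = c} = (if d i = c then insert i else id) {j \<in> I. d j = c}"
    by auto
  ultimately show ?case
    using insert nz by (simp add: order_mult del: mult_pCons_left)
qed simp

text \<open>Algebraic and geometric multiplicity agree for symmetric matrices: after diagonalisation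
  both count the indices with \<open>d i = 0\<close>.\<close>

lemma eigenvalue_count_0_eq_dim_ker:
  fixes A :: "real ^ 'n ^ 'n"
  assumes "transpose A = A"
  shows "eigenvalue_count A 0 = dim {v. A *v v = 0}"
proof -
  obtain Q d where Q: "orthogonal_matrix Q" and A: "A = transpose Q ** diag_mat d ** Q"
    using symmetric_spectral_decomposition[OF assms] .
  have QQ: "Q *v (x v* Q) = x" "(Q *v x) v* Q = x" for x
    using Q by (simp_all add: matrix_vector_mul_assoc orthogonal_matrix_def
        flip: transpose_matrix_vector)
  \<comment> \<open>The coordinate subspace on the indices with \<open>d i = 0\<close>. The kernel
    is its image under multiplication by \<open>transpose Q\<close>, which is
    \<open>\<lambda>x. x v* Q\<close>.\<close>
  let ?W = "{w :: real ^ 'n. \<forall>i. i \<notin> {i. d i = 0} \<longrightarrow> w $ i = 0}"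
  have "A *v v = 0 \<longleftrightarrow> Q *v v \<in> ?W" for v
  proof -
    have "A *v v = (diag_mat d *v (Q *v v)) v* Q"
      by (simp add: A matrix_vector_mul_assoc matrix_mul_assoc flip: transpose_matrix_vector)
    then have "A *v v = 0 \<longleftrightarrow> diag_mat d *v (Q *v v) = 0"
      by (metis QQ(1) matrix_vector_mult_0_right vector_matrix_mult_0)
    also have "\<dots> \<longleftrightarrow> Q *v v \<in> ?W"
      by (auto simp: vec_eq_iff diag_mat_mult_vec_nth)
    finally show ?thesis .
  qed
  then have "{v. A *v v = 0} = (\<lambda>x. x v* Q) ` ?W"
    by (force simp: QQ image_iff intro: QQ(2)[symmetric])
  moreover have "inj (\<lambda>x. x v* Q)"
    by (rule inj_on_inverseI[where g = "(*v) Q"]) (rule QQ(1))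
  moreover have "linear (\<lambda>x. x v* Q)"
    by (simp flip: transpose_matrix_vector)
  ultimately have "dim {v. A *v v = 0} = dim ?W"
    by (simp add: dim_image_eq inj_on_subset)
  also have "\<dots> = card {i. d i = 0}"
    by (simp only: dim_substandard_cart flip: dim_vec_eq)
  finally show ?thesis
    by (simp add: eigenvalue_count_def A charpoly_orthogonal_diag[OF Q] order_prod_linear)
qed

text \<open>The closed counterpart of \<open>pos_def\<close>: scatter matrices may be singular, and
  the compactness argument needs a closed condition.\<close>

definition pos_semidef :: "real ^ 'n ^ 'n \<Rightarrow> bool" where
  "pos_semidef A \<longleftrightarrow> transpose A = A \<and> (\<forall>x. 0 \<le> x \<bullet> (A *v x))"

lemma pos_def_imp_pos_semidef: "pos_def A \<Longrightarrow> pos_semidef A"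
  unfolding pos_def_def pos_semidef_def by (metis inner_zero_left less_eq_real_def)

text \<open>The vector is row \<open>i\<close> of \<open>Q\<close>. Each \<open>d i\<close> is thus
  a value of the quadratic form at a nonzero vector and inherits its sign.\<close>

lemma orthogonal_diag_eigenvector:
  fixes Q :: "real ^ 'n ^ 'n"
  assumes Q: "orthogonal_matrix Q"
  shows "\<exists>v. v \<noteq> 0 \<and> v \<bullet> ((transpose Q ** diag_mat d ** Q) *v v) = d i"
proof (intro exI conjI)
  let ?v = "transpose Q *v axis i 1"
  have QQ: "Q *v ?v = axis i 1"
    using Q by (simp add: matrix_vector_mul_assoc orthogonal_matrix_def del: transpose_matrix_vector)
  then show "?v \<noteq> 0"
    by (metis axis_eq_0_iff matrix_vector_mult_0_right zero_neq_one)
  have "?v \<bullet> ((transpose Q ** diag_mat d ** Q) *v ?v) = ?v \<bullet> (transpose Q *v (diag_mat d *v axis i 1))"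
    by (metis QQ matrix_vector_mul_assoc)
  also have "\<dots> = (Q *v ?v) \<bullet> (diag_mat d *v axis i 1)"
    by (metis dot_lmul_matrix vector_transpose_matrix transpose_transpose)
  also have "\<dots> = d i"
    unfolding QQ by (simp add: inner_axis' diag_mat_mult_vec_nth)
  finally show "?v \<bullet> ((transpose Q ** diag_mat d ** Q) *v ?v) = d i" .
qed

lemma pos_semidef_spectral:
  fixes A :: "real ^ 'n ^ 'n"
  assumes "pos_semidef A"
  obtains Q d where "orthogonal_matrix Q" "A = transpose Q ** diag_mat d ** Q" "\<And>i. 0 \<le> d i"
  using assms symmetric_spectral_decomposition[of A] orthogonal_diag_eigenvector
  unfolding pos_semidef_def by metis

lemma pos_def_spectral:
  fixes A :: "real ^ 'n ^ 'n"
  assumes "pos_def A"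
  obtains Q d where "orthogonal_matrix Q" "A = transpose Q ** diag_mat d ** Q" "\<And>i. 0 < d i"
  using assms symmetric_spectral_decomposition[of A] orthogonal_diag_eigenvector
  unfolding pos_def_def by metis

lemma diag_mat_mult: "diag_mat c ** diag_mat d = (diag_mat (\<lambda>i. c i * d i) :: real ^ 'n ^ 'n)"
  by (simp add: vec_eq_iff matrix_matrix_mult_def if_distrib[of "\<lambda>y. _ * y"] cong: if_cong)

lemma transpose_diag_mat [simp]: "transpose (diag_mat d) = diag_mat d"
  by (simp add: vec_eq_iff transpose_def)

text \<open>Take \<open>R\<close> to be the entrywise root of the diagonal factor times
  \<open>Q\<close>.\<close>

lemma pos_semidef_sqrt:
  fixes A :: "real ^ 'n ^ 'n"
  assumes "pos_semidef A"
  obtains R :: "real ^ 'n ^ 'n" where "A = transpose R ** R"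
proof -
  obtain Q :: "real ^ 'n ^ 'n" and d where "A = transpose Q ** diag_mat d ** Q" "\<And>i. 0 \<le> d i"
    using pos_semidef_spectral[OF assms] by metis
  then have "A = transpose (diag_mat (\<lambda>i. sqrt (d i)) ** Q) ** (diag_mat (\<lambda>i. sqrt (d i)) ** Q)"
    by (simp add: matrix_transpose_mul diag_mat_mult matrix_mul_assoc
        flip: matrix_mul_assoc[of "transpose Q" "diag_mat _" "diag_mat _"])
  with that show thesis by blast
qed

lemma pos_def_det_pos: "pos_def A \<Longrightarrow> 0 < det A"
  by (erule pos_def_spectral) (simp add: det_orthogonal_conj det_diag_mat prod_pos)

text \<open>With \<open>A = transpose R ** R\<close> the form is the squared norm of
  \<open>R *v x\<close>. If that vanishes, so does \<open>A *v x\<close>, which a nonzero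
  determinant forbids for \<open>x \<noteq> 0\<close>.\<close>

lemma pos_def_iff_pos_semidef_det:
  fixes A :: "real ^ 'n ^ 'n"
  shows "pos_def A \<longleftrightarrow> pos_semidef A \<and> det A \<noteq> 0"
proof
  assume A: "pos_semidef A \<and> det A \<noteq> 0"
  then obtain R :: "real ^ 'n ^ 'n" where R: "A = transpose R ** R"
    using pos_semidef_sqrt by blast
  have "0 < x \<bullet> (A *v x)" if "x \<noteq> 0" for x
  proof -
    have "inj ((*v) A)"
      using A by (metis bij_is_inj invertible_det_nz invertible_eq_bij)
    from injD[OF this, of x 0] that have "A *v x \<noteq> 0"
      by auto
    moreover have "A *v x = transpose R *v (R *v x)"
      by (simp add: R matrix_vector_mul_assoc)
    ultimately have "R *v x \<noteq> 0"
      by auto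
    moreover have "x \<bullet> (A *v x) = (R *v x) \<bullet> (R *v x)"
      by (subst inner_commute)
        (simp add: \<open>A *v x = transpose R *v (R *v x)\<close> dot_lmul_matrix)
    ultimately show ?thesis by simp
  qed
  with A show "pos_def A"
    by (simp add: pos_def_def pos_semidef_def)
qed (metis pos_def_imp_pos_semidef pos_def_det_pos less_irrefl)

text \<open>Sum \<open>ln d \<le> d - 1\<close> over the eigenvalues.\<close>

lemma ln_det_le_trace:
  fixes A :: "real ^ 'n ^ 'n"
  assumes "pos_def A"
  shows "ln (det A) \<le> trace A - CARD('n)"
proof -
  obtain Q d where Q: "orthogonal_matrix Q" and A: "A = transpose Q ** diag_mat d ** Q"
    and d: "\<And>i. 0 < d i"
    using pos_def_spectral[OF assms] by metis
  have "ln (det A) = (\<Sum>i\<in>UNIV. ln (d i))"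
    unfolding A using d by (simp add: det_orthogonal_conj[OF Q] det_diag_mat ln_prod less_imp_neq[THEN not_sym])
  also have "\<dots> \<le> (\<Sum>i\<in>UNIV. d i - 1)"
    using d by (intro sum_mono ln_le_minus_one)
  also have "\<dots> = trace A - CARD('n)"
    unfolding A by (simp add: trace_orthogonal_conj[OF Q] trace_diag_mat sum_subtractf)
  finally show ?thesis .
qed

text \<open>\<open>A ** B\<close> need not be symmetric, so with \<open>A = transpose R ** R\<close>
  the previous bound is applied to \<open>R ** B ** transpose R\<close>, which has the same
  determinant and trace.\<close>

lemma ln_det_add_ln_det_le_trace_mult:
  fixes A B :: "real ^ 'n ^ 'n"
  assumes A: "pos_def A" and B: "pos_def B"
  shows "ln (det A) + ln (det B) \<le> trace (A ** B) - CARD('n)"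
proof -
  obtain R :: "real ^ 'n ^ 'n" where R: "A = transpose R ** R"
    using pos_semidef_sqrt[OF pos_def_imp_pos_semidef[OF A]] .
  define C where "C = R ** B ** transpose R"
  have det: "det C = det A * det B"
    by (simp add: C_def R det_mul)
  have "det A > 0" "det B > 0"
    using A B by (auto intro: pos_def_det_pos)
  have "x \<bullet> (C *v x) = (transpose R *v x) \<bullet> (B *v (transpose R *v x))" for x
    by (simp add: C_def dot_lmul_matrix flip: matrix_vector_mul_assoc)
  moreover have "transpose C = C"
    using B by (simp add: C_def pos_def_def matrix_transpose_mul matrix_mul_assoc)
  \<comment> \<open>Semidefiniteness passes from \<open>B\<close> to \<open>C\<close>; definiteness
    then comes from the nonzero determinant.\<close>
  ultimately have "pos_semidef C"
    using pos_def_imp_pos_semidef[OF B] by (simp add: pos_semidef_def)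
  then have "pos_def C"
    using det \<open>det A > 0\<close> \<open>det B > 0\<close> by (simp add: pos_def_iff_pos_semidef_det)
  moreover have "trace C = trace (A ** B)"
    unfolding C_def R by (subst trace_mul_sym) (simp add: matrix_mul_assoc)
  ultimately show ?thesis
    using ln_det_le_trace[of C] det \<open>det A > 0\<close> \<open>det B > 0\<close> by (simp add: ln_mult)
qed

section \<open>Continuity of the determinant, entrywise bounds and trace bounds\<close>

lemma continuous_on_det [continuous_intros]:
  fixes f :: "'a::topological_space \<Rightarrow> real ^ 'n ^ 'n"
  assumes "continuous_on S f"
  shows "continuous_on S (\<lambda>x. det (f x))"
  unfolding det_def by (intro continuous_intros assms)

lemma quadratic_form_axis [simp]: "axis i 1 \<bullet> (A *v axis j 1) = A $ i $ j"
  for A :: "real ^ 'n ^ 'n"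
  by (simp add: inner_axis' matrix_vector_mult_basis column_def)

lemma pos_def_diag_pos: "pos_def A \<Longrightarrow> 0 < A $ i $ i"
  unfolding pos_def_def by (metis axis_eq_0_iff quadratic_form_axis zero_neq_one)

lemma pos_semidef_diag_nonneg: "pos_semidef A \<Longrightarrow> 0 \<le> A $ i $ i"
  unfolding pos_semidef_def by (metis quadratic_form_axis)

lemma transpose_eq_self_nth:
  assumes "transpose A = A"
  shows "A $ j $ i = A $ i $ j"
  using arg_cong[OF assms, of "\<lambda>M. M $ i $ j"] by (simp add: transpose_def)

text \<open>Testing the form on the sum and the difference of two unit vectors bounds twice the
  entry by two diagonal entries, each at most the trace.\<close>

lemma pos_semidef_entry_le_trace:
  fixes A :: "real ^ 'n ^ 'n"
  assumes "pos_semidef A"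
  shows "\<bar>A $ i $ j\<bar> \<le> trace A"
proof -
  have diag: "A $ k $ k \<le> trace A" for k
    unfolding trace_def using pos_semidef_diag_nonneg[OF assms] by (intro member_le_sum) auto
  have sym: "A $ j $ i = A $ i $ j"
    using assms by (simp add: pos_semidef_def transpose_eq_self_nth)
  have "0 \<le> (axis i 1 + c *\<^sub>R axis j 1) \<bullet> (A *v (axis i 1 + c *\<^sub>R axis j 1))" for c
    using assms by (simp add: pos_semidef_def)
  from this[of 1] this[of "-1"] have "2 * \<bar>A $ i $ j\<bar> \<le> A $ i $ i + A $ j $ j"
    by (simp add: matrix_vector_right_distrib matrix_vector_mult_diff_distrib inner_add_left
        inner_add_right inner_diff_left inner_diff_right sym)
  with diag[of i] diag[of j] show ?thesis
    by linarith
qed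

lemma trace_matrix_mult: "trace (A ** B) = (\<Sum>i\<in>UNIV. \<Sum>j\<in>UNIV. A $ i $ j * B $ j $ i)"
  by (simp add: trace_def matrix_matrix_mult_def)

text \<open>The diagonal contributes at least \<open>s * trace B\<close>, and the off-diagonal
  products cost at most the absolute entries of \<open>A\<close> times \<open>r\<close>. It is used
  both with \<open>s\<close> the least diagonal entry of \<open>S\<close> and with
  \<open>s = 0\<close>.\<close>

lemma trace_mult_ge:
  fixes A B :: "real ^ 'n ^ 'n"
  assumes "\<And>i. s \<le> A $ i $ i" "\<And>i. 0 \<le> B $ i $ i"
    and off: "\<And>i j. i \<noteq> j \<Longrightarrow> \<bar>B $ i $ j\<bar> \<le> r" and "0 \<le> r"
  shows "s * trace B - (\<Sum>i\<in>UNIV. \<Sum>j\<in>UNIV. \<bar>A $ i $ j\<bar>) * r \<le> trace (A ** B)"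
proof -
  have "s * trace B - (\<Sum>i\<in>UNIV. \<Sum>j\<in>UNIV. \<bar>A $ i $ j\<bar>) * r
      = (\<Sum>i\<in>UNIV. \<Sum>j\<in>UNIV. (if i = j then s * B $ i $ i else 0) - \<bar>A $ i $ j\<bar> * r)"
    unfolding trace_def sum_distrib_left sum_distrib_right sum_subtractf by simp
  also have "\<dots> \<le> (\<Sum>i\<in>UNIV. \<Sum>j\<in>UNIV. A $ i $ j * B $ j $ i)"
  proof (intro sum_mono)
    fix i j
    show "(if i = j then s * B $ i $ i else 0) - \<bar>A $ i $ j\<bar> * r \<le> A $ i $ j * B $ j $ i"
    proof (cases "i = j")
      case True
      have "s * B $ i $ i \<le> A $ i $ i * B $ i $ i"
        using assms(1,2) by (rule mult_right_mono)
      moreover have "0 \<le> \<bar>A $ i $ j\<bar> * r"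
        using \<open>0 \<le> r\<close> by simp
      ultimately show ?thesis
        using True by simp
    next
      case False
      have "\<bar>A $ i $ j * B $ j $ i\<bar> \<le> \<bar>A $ i $ j\<bar> * r"
        unfolding abs_mult using off[of j i] False by (intro mult_left_mono) auto
      with False show ?thesis
        by simp
    qed
  qed
  finally show ?thesis
    by (simp add: trace_matrix_mult)
qed

section \<open>Regularisation by a multiple of the identity\<close>

lemma pos_def_add_mat:
  assumes "pos_semidef S" "0 < t"
  shows "pos_def (S + mat t)"
proof -
  have "transpose (S + mat t) = S + mat t"
    using assms by (simp add: pos_semidef_def vec_eq_iff transpose_def mat_def)
  moreover have "0 < x \<bullet> ((S + mat t) *v x)" if "x \<noteq> 0" for x
  proof -
    have "x \<bullet> ((S + mat t) *v x) = x \<bullet> (S *v x) + t * (x \<bullet> x)"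
      by (simp add: mat_eq_scaleR[of t] matrix_vector_mult_add_rdistrib inner_add_right
          flip: scaleR_matrix_vector_assoc)
    with assms that show ?thesis
      by (simp add: pos_semidef_def add_nonneg_pos)
  qed
  ultimately show ?thesis
    by (simp add: pos_def_def)
qed

lemma pos_def_mat: "0 < t \<Longrightarrow> pos_def (mat t)"
  using pos_def_add_mat[of 0 t] by (simp add: pos_semidef_def transpose_def vec_eq_iff)

lemma trace_add_mat_mult: "trace ((S + mat t) ** A) = trace (S ** A) + t * trace A"
  for A :: "real ^ 'n ^ 'n"
  by (simp add: mat_eq_scaleR[of t] matrix_add_rdistrib trace_def sum_distrib_left sum.distrib
      flip: scalar_matrix_assoc)

text \<open>The eigenvalues of \<open>S + mat t\<close> are \<open>d i + t\<close>. Bound this below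
  by \<open>t\<close> where \<open>d i = 0\<close> and by \<open>d i\<close> elsewhere;
  \<open>c\<close> is the product of the nonzero eigenvalues.\<close>

lemma det_add_mat_ge:
  fixes S :: "real ^ 'n ^ 'n"
  assumes "pos_semidef S"
  obtains c where "0 < c" "\<And>t. 0 \<le> t \<Longrightarrow> c * t ^ eigenvalue_count S 0 \<le> det (S + mat t)"
proof -
  obtain Q d where Q: "orthogonal_matrix Q" and S: "S = transpose Q ** diag_mat d ** Q"
    and d: "\<And>i. 0 \<le> d i"
    using pos_semidef_spectral[OF assms] by metis
  have count: "eigenvalue_count S 0 = card {i. d i = 0}"
    by (simp add: eigenvalue_count_def S charpoly_orthogonal_diag[OF Q] order_prod_linear)
  define c where "c = (\<Prod>i\<in>{i. d i \<noteq> 0}. d i)"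
  have "0 < c"
    unfolding c_def using d by (intro prod_pos) (auto simp: less_le)
  moreover have "c * t ^ eigenvalue_count S 0 \<le> det (S + mat t)" if "0 \<le> t" for t
  proof -
    have "transpose Q ** diag_mat (\<lambda>i. d i + t) ** Q = S + mat t"
    proof -
      have "diag_mat (\<lambda>i. d i + t) = diag_mat d + t *\<^sub>R mat 1"
        by (simp add: vec_eq_iff mat_def)
      moreover have "transpose Q ** (t *\<^sub>R mat 1) ** Q = t *\<^sub>R (transpose Q ** Q)"
        by (simp add: matrix_scalar_ac scalar_matrix_assoc)
      ultimately show ?thesis
        using Q by (simp add: S matrix_add_ldistrib matrix_add_rdistrib orthogonal_matrix_def
            mat_eq_scaleR[of t])
    qed
    then have "det (S + mat t) = (\<Prod>i\<in>UNIV. d i + t)"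
      by (metis det_orthogonal_conj[OF Q] det_diag_mat)
    moreover have "(\<Prod>i\<in>UNIV. if d i = 0 then t else d i) \<le> (\<Prod>i\<in>UNIV. d i + t)"
      using d that by (intro prod_mono) auto
    moreover have "(\<Prod>i\<in>UNIV. if d i = 0 then t else d i) = c * t ^ eigenvalue_count S 0"
      by (simp add: prod.If_cases c_def count Collect_neg_eq)
    ultimately show ?thesis
      by simp
  qed
  ultimately show thesis
    by (rule that)
qed

subsection \<open>Existence of the maximiser\<close>

lemma closed_pos_semidef: "closed {A :: real ^ 'n ^ 'n. pos_semidef A}"
proof -
  have "{A :: real ^ 'n ^ 'n. pos_semidef A}
      = (\<Inter>i. \<Inter>j. {A. A $ j $ i = A $ i $ j}) \<inter> (\<Inter>x. {A. 0 \<le> (\<Sum>i\<in>UNIV. \<Sum>j\<in>UNIV. x $ i * (A $ i $ j * x $ j))})"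
    by (auto simp: pos_semidef_def vec_eq_iff transpose_def inner_vec_def matrix_vector_mult_def
        sum_distrib_left)
  also have "closed \<dots>"
    by (intro closed_Int closed_INT ballI closed_Collect_eq closed_Collect_le continuous_intros)
  finally show ?thesis .
qed

lemma continuous_on_trace [continuous_intros]:
  fixes f :: "'a::topological_space \<Rightarrow> real ^ 'n ^ 'n"
  assumes "continuous_on S f"
  shows "continuous_on S (\<lambda>x. trace (f x))"
  unfolding trace_def by (intro continuous_intros assms)

lemma continuous_on_matrix_mult_left [continuous_intros]:
  fixes f :: "'a::topological_space \<Rightarrow> real ^ 'n ^ 'n"
  assumes "continuous_on S f"
  shows "continuous_on S (\<lambda>x. A ** f x)"
  unfolding matrix_matrix_mult_def by (intro continuous_intros assms)

text \<open>The trace bounds all entries of a semidefinite matrix. For positive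
  \<open>\<delta>\<close> the last condition keeps the set away from singular matrices.\<close>

lemma compact_pos_semidef_trace_le_det_ge:
  "compact {A :: real ^ 'n ^ 'n. pos_semidef A \<and> trace A \<le> C \<and> \<delta> \<le> det A}" (is "compact ?K")
proof -
  have "?K = {A. pos_semidef A} \<inter> {A. trace A \<le> C} \<inter> {A. \<delta> \<le> det A}"
    by auto
  also have "closed \<dots>"
    by (intro closed_Int closed_pos_semidef closed_Collect_le continuous_intros)
  finally have "closed ?K" .
  moreover have "bounded ?K"
  proof (rule boundedI)
    fix A assume "A \<in> ?K"
    then have "\<bar>A $ i $ j\<bar> \<le> C" for i j
      using pos_semidef_entry_le_trace[of A i j] by auto
    then have "norm (A $ i) \<le> CARD('n) * C" for i
      by (intro order.trans[OF norm_le_l1_cart] sum_bounded_above[THEN order.trans]) auto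
    have "norm A \<le> (\<Sum>i\<in>UNIV. norm (A $ i))"
      unfolding norm_vec_def by (rule L2_set_le_sum) auto
    also have "\<dots> \<le> CARD('n) * (CARD('n) * C)"
      using \<open>\<And>i. norm (A $ i) \<le> CARD('n) * C\<close>
      by (intro sum_bounded_above[THEN order.trans]) auto
    finally show "norm A \<le> CARD('n) * (CARD('n) * C)" .
  qed
  ultimately show ?thesis
    by (simp add: compact_eq_bounded_closed)
qed

lemma l_Pen_pos_def:
  assumes "\<And>x. 0 < x \<Longrightarrow> pen\<^sub>D x = 0" "pos_def \<Theta>"
  shows "l_Pen pen\<^sub>D pen S \<Theta> =
    ln (det \<Theta>) - trace (S ** \<Theta>) - (\<Sum>(i, j)\<in>{(i, j). i < j}. pen (\<Theta> $ i $ j))"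
  using assms pos_def_diag_pos[OF assms(2)] by (simp add: l_Pen_def Pen_def)

lemma pen_le_sum_offdiag:
  fixes \<Theta> :: "real ^ ('p::{finite,linorder}) ^ ('p::{finite,linorder})"
    and pen :: "real \<Rightarrow> real"
  assumes nonneg: "\<And>x. 0 \<le> pen x" and sym: "transpose \<Theta> = \<Theta>" and "i \<noteq> j"
  shows "pen (\<Theta> $ i $ j) \<le> (\<Sum>(i, j)\<in>{(i, j). i < j}. pen (\<Theta> $ i $ j))"
proof -
  \<comment> \<open>The penalty sums over \<open>i < j\<close> only, so an entry below the diagonal
    is replaced by its mirror image.\<close>
  define a b where "a = min i j" and "b = max i j"
  have "\<Theta> $ i $ j = \<Theta> $ j $ i"
    using sym by (rule transpose_eq_self_nth[symmetric])
  then have "\<Theta> $ i $ j = \<Theta> $ a $ b" "a < b"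
    using \<open>i \<noteq> j\<close> by (auto simp: a_def b_def min_def max_def)
  then show ?thesis
    using nonneg member_le_sum[of "(a, b)" "{(i, j). i < j}" "\<lambda>(i, j). pen (\<Theta> $ i $ j)"]
    by (auto simp: case_prod_beta)
qed

text \<open>Coercivity. The threshold \<open>\<epsilon> * T\<close> separates the regime where the
  linear term \<open>trace (S ** \<Theta>)\<close> wins from the one where the penalty wins.\<close>

lemma superlevel_trace_bounded:
  fixes S :: "real ^ ('p::{finite,linorder}) ^ ('p::{finite,linorder})"
  assumes pen_nonneg: "\<And>x. 0 \<le> pen x"
    and pen_mono: "\<And>x y. \<bar>x\<bar> \<le> \<bar>y\<bar> \<Longrightarrow> pen x \<le> pen y"
    and growth: "\<And>x. R \<le> x \<Longrightarrow> K * ln x \<le> pen x"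
    and K: "real (eigenvalue_count S 0) < K"
    and S: "pos_semidef S" "\<And>i. 0 < S $ i $ i"
  obtains C where "\<And>\<Theta>. pos_def \<Theta> \<Longrightarrow>
     L \<le> ln (det \<Theta>) - trace (S ** \<Theta>) - (\<Sum>(i, j)\<in>{(i, j). i < j}. pen (\<Theta> $ i $ j)) \<Longrightarrow>
     trace \<Theta> \<le> C"
proof -
  define m where "m = eigenvalue_count S 0"
  define s where "s = Min (range (\<lambda>i. S $ i $ i))"
  have "0 < s" "\<And>i. s \<le> S $ i $ i"
    using S(2) by (simp_all add: s_def)
  define B where "B = (\<Sum>i\<in>UNIV. \<Sum>j\<in>UNIV. \<bar>S $ i $ j\<bar>)"
  have "0 \<le> B"
    by (simp add: B_def sum_nonneg)
  \<comment> \<open>Off-diagonal entries up to \<open>\<epsilon> * T\<close> then cost at most half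
    of the diagonal gain \<open>s * T\<close>; the \<open>+ 1\<close> keeps the denominator
    positive.\<close>
  define \<epsilon> where "\<epsilon> = s / (2 * (B + 1))"
  have "0 < \<epsilon>" and B\<epsilon>: "B * \<epsilon> \<le> s / 2"
    using \<open>0 < s\<close> \<open>0 \<le> B\<close> by (simp_all add: \<epsilon>_def field_simps)
  obtain c where "0 < c" and c: "\<And>t. 0 \<le> t \<Longrightarrow> c * t ^ m \<le> det (S + mat t)"
    using det_add_mat_ge[OF S(1)] unfolding m_def by metis
  \<comment> \<open>Using \<open>E\<close> in the log-determinant inequality spends
    \<open>s / 4 * T\<close> of the available \<open>s / 2 * T\<close>, leaving a linear term that
    gives \<open>C1\<close>.\<close>
  define E :: "real ^ ('p::{finite,linorder}) ^ ('p::{finite,linorder})" where "E = mat (s / 4)"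
  define C1 where "C1 = - (L + CARD('p) + ln (det E)) / (s / 4)"
  define C2 where "C2 = exp ((1 - real CARD('p) - ln c - K * ln \<epsilon> - L) / (K - m))"
  show thesis
  proof (rule that)
    fix \<Theta> :: "real ^ ('p::{finite,linorder}) ^ ('p::{finite,linorder})"
    assume \<Theta>: "pos_def \<Theta>"
    define P where "P = (\<Sum>(i, j)\<in>{(i, j). i < j}. pen (\<Theta> $ i $ j))"
    assume "L \<le> ln (det \<Theta>) - trace (S ** \<Theta>) - (\<Sum>(i, j)\<in>{(i, j). i < j}. pen (\<Theta> $ i $ j))"
    then have L: "L \<le> ln (det \<Theta>) - trace (S ** \<Theta>) - P"
      by (simp add: P_def)
    define T where "T = trace \<Theta>"
    have diag: "0 < \<Theta> $ i $ i" for i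
      by (rule pos_def_diag_pos[OF \<Theta>])
    then have "0 < T"
      unfolding T_def trace_def by (intro sum_pos) auto
    \<comment> \<open>The alternatives: all off-diagonal entries small; one large but
      \<open>\<epsilon> * T\<close> still below the growth threshold \<open>R\<close>; one large and
      the logarithmic growth of \<open>pen\<close> in force.\<close>
    have "T \<le> C1 \<or> T \<le> R / \<epsilon> \<or> T \<le> C2"
    proof (cases "\<forall>i j. i \<noteq> j \<longrightarrow> \<bar>\<Theta> $ i $ j\<bar> \<le> \<epsilon> * T")
      case True
      have "s * T - B * (\<epsilon> * T) \<le> trace (S ** \<Theta>)"
        unfolding T_def B_def
        using True \<open>\<And>i. s \<le> S $ i $ i\<close> diag[THEN less_imp_le] \<open>0 < T\<close> \<open>0 < \<epsilon>\<close>
        by (intro trace_mult_ge) (auto simp: T_def)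
      moreover have "B * (\<epsilon> * T) \<le> s / 2 * T"
        using mult_right_mono[OF B\<epsilon>, of T] \<open>0 < T\<close> by (simp add: mult.assoc)
      ultimately have "s / 2 * T \<le> trace (S ** \<Theta>)"
        by simp
      moreover have "0 \<le> P"
        unfolding P_def by (intro sum_nonneg) (auto intro: pen_nonneg)
      moreover have "ln (det E) + ln (det \<Theta>) \<le> s / 4 * T - CARD('p)"
        using ln_det_add_ln_det_le_trace_mult[OF pos_def_mat \<Theta>, of "s / 4"] \<open>0 < s\<close>
          trace_add_mat_mult[of 0 "s / 4" \<Theta>]
        by (simp add: T_def trace_def E_def)
      ultimately have "T * (s / 4) \<le> - (L + CARD('p) + ln (det E))"
        using L by (simp add: algebra_simps)
      then have "T \<le> C1"
        using \<open>0 < s\<close> unfolding C1_def by (subst pos_le_divide_eq) auto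
      then show ?thesis ..
    next
      case False
      then obtain i j where "i \<noteq> j" and ij: "\<epsilon> * T < \<bar>\<Theta> $ i $ j\<bar>"
        by fastforce
      show ?thesis
      proof (cases "R \<le> \<epsilon> * T")
        case True
        then have "K * ln (\<epsilon> * T) \<le> pen (\<epsilon> * T)"
          by (rule growth)
        also have "\<dots> \<le> pen (\<Theta> $ i $ j)"
          using ij \<open>0 < T\<close> \<open>0 < \<epsilon>\<close> by (intro pen_mono) auto
        also have "\<dots> \<le> P"
          unfolding P_def
          using pen_nonneg \<Theta> \<open>i \<noteq> j\<close> by (intro pen_le_sum_offdiag) (auto simp: pos_def_def)
        finally have P: "K * (ln \<epsilon> + ln T) \<le> P"
          using \<open>0 < T\<close> \<open>0 < \<epsilon>\<close> by (simp add: ln_mult)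
        \<comment> \<open>The weight \<open>1 / T\<close> makes the regularisation add exactly 1 to
          the trace, while the determinant drops no faster than \<open>T\<close> to the power
          \<open>-m\<close>.\<close>
        have "ln (det (S + mat (1 / T))) + ln (det \<Theta>) \<le> trace (S ** \<Theta>) + 1 - CARD('p)"
          using ln_det_add_ln_det_le_trace_mult[OF pos_def_add_mat[OF S(1)] \<Theta>, of "1 / T"]
            \<open>0 < T\<close> by (simp add: trace_add_mat_mult T_def)
        moreover have "ln c - m * ln T \<le> ln (det (S + mat (1 / T)))"
        proof -
          have "0 < c * (1 / T) ^ m"
            using \<open>0 < c\<close> \<open>0 < T\<close> by simp
          moreover have "c * (1 / T) ^ m \<le> det (S + mat (1 / T))"
            using c \<open>0 < T\<close> by simp
          ultimately have "ln (c * (1 / T) ^ m) \<le> ln (det (S + mat (1 / T)))"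
            by simp
          moreover have "ln (c * (1 / T) ^ m) = ln c - m * ln T"
            using \<open>0 < c\<close> \<open>0 < T\<close> by (simp add: ln_mult ln_realpow ln_div power_divide)
          ultimately show ?thesis
            by simp
        qed
        \<comment> \<open>The penalty supplies \<open>K * ln T\<close> against a loss of
          \<open>m * ln T\<close>; since \<open>m < K\<close> this bounds \<open>T\<close>.\<close>
        ultimately have "ln T * (K - m) \<le> 1 - real CARD('p) - ln c - K * ln \<epsilon> - L"
          using L P by (simp add: algebra_simps)
        then have "ln T \<le> (1 - real CARD('p) - ln c - K * ln \<epsilon> - L) / (K - m)"
          using K by (simp add: pos_le_divide_eq m_def)
        then have "T \<le> C2"
          unfolding C2_def using \<open>0 < T\<close> by (metis exp_le_cancel_iff exp_ln)
        then show ?thesis by simp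
      next
        case False
        then show ?thesis
          using \<open>0 < \<epsilon>\<close> by (simp add: field_simps)
      qed
    qed
    then show "trace \<Theta> \<le> max C1 (max (R / \<epsilon>) C2)"
      by (auto simp: T_def)
  qed
qed

text \<open>The identity is the reference point: its superlevel set lies in a compact set
  \<open>V\<close> of positive definite matrices, on which the objective is continuous.\<close>

lemma penalised_estimate_existsI:
  fixes S :: "real ^ ('p::{finite,linorder}) ^ ('p::{finite,linorder})"
  assumes pen_nonneg: "\<And>x. 0 \<le> pen x"
    and pen_mono: "\<And>x y. \<bar>x\<bar> \<le> \<bar>y\<bar> \<Longrightarrow> pen x \<le> pen y"
    and pen_cont: "continuous_on UNIV pen"
    and pen_D: "\<And>x. 0 < x \<Longrightarrow> pen\<^sub>D x = 0"
    and growth: "\<And>x. R \<le> x \<Longrightarrow> K * ln x \<le> pen x"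
    and K: "real (eigenvalue_count S 0) < K"
    and S: "pos_semidef S" "\<And>i. 0 < S $ i $ i"
  shows "penalised_estimate_exists pen\<^sub>D pen S"
proof -
  \<comment> \<open>The objective without the diagonal penalty; it agrees with \<open>l_Pen\<close>
    on positive definite matrices, whose diagonals are positive.\<close>
  define F where "F \<Theta> = ln (det \<Theta>) - trace (S ** \<Theta>) - (\<Sum>(i, j)\<in>{(i, j). i < j}. pen (\<Theta> $ i $ j))"
    for \<Theta> :: "real ^ ('p::{finite,linorder}) ^ ('p::{finite,linorder})"
  define I :: "real ^ ('p::{finite,linorder}) ^ ('p::{finite,linorder})" where "I = mat 1"
  have I: "pos_def I"
    by (simp add: I_def pos_def_mat)
  obtain C where C: "\<And>\<Theta>. pos_def \<Theta> \<Longrightarrow> F I \<le> F \<Theta> \<Longrightarrow> trace \<Theta> \<le> C"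
    using superlevel_trace_bounded[of pen R K S "F I", OF pen_nonneg pen_mono growth K S, folded F_def]
    by blast
  define B where "B = (\<Sum>i\<in>UNIV. \<Sum>j\<in>UNIV. \<bar>S $ i $ j\<bar>)"
  \<comment> \<open>On the superlevel set \<open>trace (S ** \<Theta>)\<close> is at least
    \<open>- B * C\<close> and the penalty is nonnegative, so \<open>ln (det \<Theta>)\<close> is at
    least \<open>F I - B * C\<close>.\<close>
  define \<delta> where "\<delta> = exp (F I - B * C)"
  define V where "V = {A :: real ^ ('p::{finite,linorder}) ^ ('p::{finite,linorder}). pos_semidef A \<and> trace A \<le> C \<and> \<delta> \<le> det A}"
  have V: "pos_def \<Theta>" if "\<Theta> \<in> V" for \<Theta>
    using that by (auto simp: V_def pos_def_iff_pos_semidef_det \<delta>_def)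
  have mem_V: "\<Theta> \<in> V" if \<Theta>: "pos_def \<Theta>" "F I \<le> F \<Theta>" for \<Theta>
  proof -
    have psd: "pos_semidef \<Theta>"
      by (rule pos_def_imp_pos_semidef[OF \<Theta>(1)])
    have entry: "\<bar>\<Theta> $ i $ j\<bar> \<le> C" for i j
      using pos_semidef_entry_le_trace[OF psd, of i j] C[OF \<Theta>] by linarith
    moreover from this have "0 \<le> C"
      using abs_ge_zero order.trans by blast
    ultimately have "0 * trace \<Theta> - B * C \<le> trace (S ** \<Theta>)"
      unfolding B_def
      by (intro trace_mult_ge) (auto simp: S less_imp_le pos_semidef_diag_nonneg[OF psd])
    moreover have "0 \<le> (\<Sum>(i, j)\<in>{(i, j). i < j}. pen (\<Theta> $ i $ j))"
      by (intro sum_nonneg) (auto intro: pen_nonneg)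
    ultimately have "F I - B * C \<le> ln (det \<Theta>)"
      using \<Theta>(2) by (simp add: F_def[of \<Theta>])
    then have "\<delta> \<le> det \<Theta>"
      unfolding \<delta>_def using pos_def_det_pos[OF \<Theta>(1)] by (simp add: ln_ge_iff)
    with psd C[OF \<Theta>] show ?thesis
      by (simp add: V_def)
  qed
  have "compact V"
    unfolding V_def by (rule compact_pos_semidef_trace_le_det_ge)
  moreover have "I \<in> V"
    using mem_V[OF I] by simp
  moreover have "continuous_on V F"
    unfolding F_def case_prod_beta
    by (intro continuous_intros continuous_on_compose2[OF pen_cont])
      (use V pos_def_det_pos in force)+
  ultimately obtain \<Theta>' where "\<Theta>' \<in> V" and max: "\<And>\<Theta>. \<Theta> \<in> V \<Longrightarrow> F \<Theta> \<le> F \<Theta>'"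
    using continuous_attains_sup[of V F] by blast
  \<comment> \<open>A positive definite matrix outside \<open>V\<close> lies below
    \<open>F I\<close>, hence below the maximum over \<open>V\<close>.\<close>
  have le: "l_Pen pen\<^sub>D pen S \<Theta> \<le> l_Pen pen\<^sub>D pen S \<Theta>'" if "pos_def \<Theta>" for \<Theta>
  proof -
    have "F \<Theta> \<le> F \<Theta>'"
      using mem_V[OF that] max[of \<Theta>] max[OF \<open>I \<in> V\<close>] by linarith
    then show ?thesis
      using that V[OF \<open>\<Theta>' \<in> V\<close>] by (simp add: l_Pen_pos_def[OF pen_D] F_def)
  qed
  moreover have "pos_def \<Theta>'"
    by (rule V) fact
  ultimately show ?thesis
    unfolding penalised_estimate_exists_def
    by (intro conjI exI[of _ \<Theta>'] bdd_aboveI2[where M = "l_Pen pen\<^sub>D pen S \<Theta>'"]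
        cSup_eq_maximum[symmetric]) auto
qed

subsection \<open>The kernel of a scatter matrix\<close>

lemma scatter_about_mult_vec:
  "scatter_about c n x *v v = (1 / real n) *\<^sub>R (\<Sum>k=1..n. ((x k - c) \<bullet> v) *\<^sub>R (x k - c))"
proof -
  have "(\<Sum>k=1..n. \<chi> i j. (x k - c) $ i * (x k - c) $ j) *v v
      = (\<Sum>k=1..n. ((x k - c) \<bullet> v) *\<^sub>R (x k - c))"
    by (simp add: vec_eq_iff matrix_vector_mult_def inner_vec_def sum_distrib_left
        sum_distrib_right sum.swap[of _ UNIV] mult_ac)
  then show ?thesis
    by (simp add: scatter_about_def flip: scaleR_matrix_vector_assoc)
qed

lemma quadratic_form_scatter_about:
  "v \<bullet> (scatter_about c n x *v v) = (1 / real n) * (\<Sum>k=1..n. ((x k - c) \<bullet> v)\<^sup>2)"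
  by (simp add: scatter_about_mult_vec inner_sum_right inner_commute power2_eq_square)

lemma pos_semidef_scatter_about: "pos_semidef (scatter_about c n x)"
proof -
  have "transpose (scatter_about c n x) = scatter_about c n x"
    by (simp add: scatter_about_def vec_eq_iff transpose_def mult.commute)
  then show ?thesis
    by (simp add: pos_semidef_def quadratic_form_scatter_about sum_nonneg)
qed

lemma scatter_about_quadratic_form_eq_0_iff:
  assumes "1 \<le> n"
  shows "v \<bullet> (scatter_about c n x *v v) = 0 \<longleftrightarrow> (\<forall>k\<in>{1..n}. (x k - c) \<bullet> v = 0)"
  using assms by (simp add: quadratic_form_scatter_about sum_nonneg_eq_0_iff)

text \<open>A kernel vector annihilates the quadratic form, which is a sum of squares up to a
  positive factor.\<close>

lemma scatter_about_ker:
  assumes "1 \<le> n"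
  shows "scatter_about c n x *v v = 0 \<longleftrightarrow> (\<forall>k\<in>{1..n}. (x k - c) \<bullet> v = 0)"
proof
  assume "scatter_about c n x *v v = 0"
  then have "v \<bullet> (scatter_about c n x *v v) = 0"
    by simp
  then show "\<forall>k\<in>{1..n}. (x k - c) \<bullet> v = 0"
    by (simp only: scatter_about_quadratic_form_eq_0_iff[OF assms])
qed (simp add: scatter_about_mult_vec)

text \<open>Both sides say that \<open>x k \<bullet> v\<close> does not depend on \<open>k\<close>.
  This trades the sample mean, which involves every observation, for the first observation, which is
  independent of the remaining \<open>n - 1\<close>.\<close>

lemma centred_inner_eq_0_iff:
  assumes "1 \<le> n"
  shows "(\<forall>k\<in>{1..n}. (x k - sample_mean n x) \<bullet> v = 0) \<longleftrightarrow> (\<forall>k\<in>{2..n}. (x k - x 1) \<bullet> v = 0)"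
proof
  assume *: "\<forall>k\<in>{1..n}. (x k - sample_mean n x) \<bullet> v = 0"
  have "x k \<bullet> v = sample_mean n x \<bullet> v" if "k \<in> {1..n}" for k
    using * that by (simp add: inner_diff_left)
  then show "\<forall>k\<in>{2..n}. (x k - x 1) \<bullet> v = 0"
    using assms by (simp add: inner_diff_left)
next
  assume *: "\<forall>k\<in>{2..n}. (x k - x 1) \<bullet> v = 0"
  have eq: "x k \<bullet> v = x 1 \<bullet> v" if "k \<in> {1..n}" for k
  proof (cases "k = 1")
    case False
    with that have "k \<in> {2..n}"
      by auto
    with * have "(x k - x 1) \<bullet> v = 0"
      by blast
    then show ?thesis
      by (simp add: inner_diff_left)
  qed simp
  have "(\<Sum>k=1..n. x k \<bullet> v) = (\<Sum>k=1..n. x 1 \<bullet> v)"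
    by (rule sum.cong[OF refl eq])
  then have "sample_mean n x \<bullet> v = x 1 \<bullet> v"
    using assms by (simp add: sample_mean_def inner_sum_left)
  then show "\<forall>k\<in>{1..n}. (x k - sample_mean n x) \<bullet> v = 0"
    by (intro ballI) (simp only: inner_diff_left eq)
qed

lemma dim_orthogonal_to_family:
  fixes y :: "'i \<Rightarrow> real ^ 'n"
  shows "dim {v. \<forall>k\<in>K. y k \<bullet> v = 0} + dim (y ` K) = CARD('n)"
proof -
  have "{v. \<forall>k\<in>K. y k \<bullet> v = 0} = {v \<in> UNIV. \<forall>u\<in>span (y ` K). orthogonal u v}"
  proof safe
    fix v u assume "\<forall>k\<in>K. y k \<bullet> v = 0" "u \<in> span (y ` K)"
    then have "orthogonal v u"
      by (intro orthogonal_to_span[of u "y ` K"]) (auto simp: orthogonal_def inner_commute[of v])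
    then show "orthogonal u v"
      by (simp add: orthogonal_commute)
  next
    fix v k assume "\<forall>u\<in>span (y ` K). orthogonal u v" "k \<in> K"
    then show "y k \<bullet> v = 0"
      by (auto simp: orthogonal_def intro: span_base)
  qed auto
  then show ?thesis
    using dim_subspace_orthogonal_to_vectors[of "span (y ` K)" UNIV] by simp
qed

text \<open>Maximal rank is certified by one determinant: selected vectors fill the rows in
  \<open>J\<close>, unit vectors the others, and the rows of a nonsingular matrix are distinct and
  independent.\<close>

lemma dim_family_eq_min:
  fixes y :: "'i \<Rightarrow> real ^ 'n"
  assumes "finite K" and \<sigma>: "\<sigma> ` J \<subseteq> K" and card: "card J = min (card K) CARD('n)"
    and det: "det (\<chi> j. if j \<in> J then y (\<sigma> j) else axis j 1) \<noteq> 0"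
  shows "dim (y ` K) = min (card K) CARD('n)"
proof (rule antisym)
  have "dim (y ` K) \<le> card (y ` K)"
    using \<open>finite K\<close> by (intro dim_le_card') auto
  also have "\<dots> \<le> card K"
    by (rule card_image_le) fact
  finally show "dim (y ` K) \<le> min (card K) CARD('n)"
    using dim_subset_UNIV_cart[of "y ` K"] by simp
next
  define A where "A = (\<chi> j. if j \<in> J then y (\<sigma> j) else axis j 1)"
  have "independent (rows A)"
    using det det_dependent_rows[of A] by (auto simp: A_def dependent_vec_eq[symmetric])
  moreover have rows: "row j A = y (\<sigma> j)" if "j \<in> J" for j
    using that by (simp add: A_def row_def)
  then have "(\<lambda>j. y (\<sigma> j)) ` J \<subseteq> rows A"
    by (auto simp: rows_def) metis
  ultimately have ind: "independent ((\<lambda>j. y (\<sigma> j)) ` J)"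
    by (rule independent_mono)
  have "inj_on (\<lambda>j. y (\<sigma> j)) J"
  proof (rule inj_onI, rule ccontr)
    fix i j assume "i \<in> J" "j \<in> J" "y (\<sigma> i) = y (\<sigma> j)" "i \<noteq> j"
    with rows det_identical_rows[of i j A] det show False
      by (simp add: A_def)
  qed
  then have "min (card K) CARD('n) = card ((\<lambda>j. y (\<sigma> j)) ` J)"
    by (simp add: card_image card)
  also have "\<dots> \<le> dim (y ` K)"
    using \<sigma> by (intro independent_card_le_dim ind) auto
  finally show "min (card K) CARD('n) \<le> dim (y ` K)" .
qed

subsection \<open>General position of independent vectors with densities\<close>

text \<open>By independence the joint law is a product measure, so Fubini allows \<open>Y\<close> to
  be frozen at an arbitrary value.\<close>

lemma (in prob_space) AE_indep_var_pair:
  assumes ind: "indep_var N Y L Z"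
    and meas: "{w \<in> space (N \<Otimes>\<^sub>M L). P (fst w) (snd w)} \<in> sets (N \<Otimes>\<^sub>M L)"
    and ae: "\<And>y. y \<in> space N \<Longrightarrow> AE \<omega> in M. P y (Z \<omega>)"
  shows "AE \<omega> in M. P (Y \<omega>) (Z \<omega>)"
proof -
  have YZ [measurable]: "random_variable N Y" "random_variable L Z"
    and eq: "distr M N Y \<Otimes>\<^sub>M distr M L Z = distr M (N \<Otimes>\<^sub>M L) (\<lambda>x. (Y x, Z x))"
    using ind unfolding indep_var_distribution_eq by auto
  interpret Y: prob_space "distr M N Y" by (rule prob_space_distr) fact
  interpret Z: prob_space "distr M L Z" by (rule prob_space_distr) fact
  interpret YZ: pair_sigma_finite "distr M N Y" "distr M L Z" ..
  have "AE w in distr M N Y \<Otimes>\<^sub>M distr M L Z. P (fst w) (snd w)"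
  proof (rule YZ.AE_pair_measure)
    show "{w \<in> space (distr M N Y \<Otimes>\<^sub>M distr M L Z). P (fst w) (snd w)}
        \<in> sets (distr M N Y \<Otimes>\<^sub>M distr M L Z)"
      using meas by (simp add: eq)
    show "AE y in distr M N Y. AE z in distr M L Z. P (fst (y, z)) (snd (y, z))"
    proof (rule AE_I2)
      fix y assume "y \<in> space (distr M N Y)"
      then have y: "y \<in> space N"
        by simp
      have "Pair y -` {w \<in> space (N \<Otimes>\<^sub>M L). P (fst w) (snd w)} = {z \<in> space L. P y z}"
        using y by (auto simp: space_pair_measure)
      then have "{z \<in> space L. P y z} \<in> sets L"
        using sets_Pair1[OF meas, of y] by simp
      with ae[OF y] show "AE z in distr M L Z. P (fst (y, z)) (snd (y, z))"
        by (simp add: AE_distr_iff)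
    qed
  qed
  then show ?thesis
    unfolding eq by (subst (asm) AE_distr_iff) (use meas in auto)
qed

lemma borel_measurable_det_rows [measurable (raw)]:
  fixes F :: "'n::finite \<Rightarrow> 'a \<Rightarrow> real ^ 'n"
  assumes "\<And>i. F i \<in> borel_measurable M"
  shows "(\<lambda>x. det (\<chi> i. F i x)) \<in> borel_measurable M"
proof -
  have [measurable]: "(\<lambda>x. F i x $ j) \<in> borel_measurable M" for i j
    using borel_measurable_inner[OF assms[of i] borel_measurable_const[of "axis j 1"]]
    by (simp add: inner_axis)
  show ?thesis
    unfolding det_def by simp
qed

text \<open>The determinant is linear in row \<open>j\<close>, and \<open>v\<close> shows that its
  zero set is a proper subspace; a translate of such a subspace is a Lebesgue null set.\<close>

lemma AE_lborel_det_row_ne_0: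
  fixes G :: "'n::finite \<Rightarrow> real ^ 'n"
  assumes "det (\<chi> i. if i = j then v else G i) \<noteq> 0"
  shows "AE x in lborel. det (\<chi> i. if i = j then x - b else G i) \<noteq> 0"
proof -
  define \<phi> where "\<phi> r = det (\<chi> i. if i = j then r else G i)" for r :: "real ^ 'n"
  have "linear \<phi>"
    using det_row_add[of j "\<lambda>_. _" "\<lambda>_. _" G] det_row_mul[of j _ "\<lambda>_. _" G]
    by (intro linearI) (simp_all add: \<phi>_def flip: scalar_mult_eq_scaleR)
  define W where "W = {r. \<phi> r = 0}"
  have "subspace W"
    unfolding W_def by (rule linear_subspace_kernel) fact
  moreover have "W \<noteq> UNIV"
    using assms by (auto simp: W_def \<phi>_def)
  ultimately have "dim W < DIM(real ^ 'n)"
    by (metis dim_eq_full dim_subset_UNIV less_le span_eq_iff)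
  then have "negligible ((+) b ` W)"
    by (intro negligible_translation negligible_lowdim)
  moreover have "closed ((+) b ` W)"
    by (intro closed_translation closed_subspace) fact
  then have "(+) b ` W \<in> sets lborel"
    by simp
  ultimately have "(+) b ` W \<in> null_sets lborel"
    by (simp add: negligible_iff_null_sets null_sets_completion_iff)
  then show ?thesis
    by (rule AE_I') (auto simp: W_def \<phi>_def image_iff intro!: exI[of _ "_ - b"])
qed

text \<open>The rows indexed by \<open>J\<close> are inserted one at a time: given the random vectors used so far, the
  determinant is a nonzero linear function of the new row.\<close>

lemma (in prob_space) AE_det_centred_rows_ne_0:
  fixes X :: "nat \<Rightarrow> 'a \<Rightarrow> real ^ 'n"
  assumes ind: "indep_vars (\<lambda>_. borel) X I"
    and dens: "\<And>i. i \<in> I \<Longrightarrow> distributed M lborel (X i) (f i)"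
    and b: "b \<in> borel_measurable (PiM I0 (\<lambda>_. borel))" and "I0 \<subseteq> I"
    and "finite J" "inj_on \<sigma> J" "\<sigma> ` J \<subseteq> I - I0"
  shows "AE \<omega> in M. det (\<chi> j. if j \<in> J then X (\<sigma> j) \<omega> - b (\<lambda>i\<in>I0. X i \<omega>) else axis j 1) \<noteq> 0"
  using \<open>finite J\<close> \<open>inj_on \<sigma> J\<close> \<open>\<sigma> ` J \<subseteq> I - I0\<close>
proof (induction J)
  case empty
  have "(\<chi> j. axis j 1) = (mat 1 :: real ^ 'n ^ 'n)"
    by (simp add: vec_eq_iff mat_def axis_def)
  then show ?case
    by simp
next
  case (insert j J)
  \<comment> \<open>The indices already revealed: those that determine the centre \<open>b\<close>
    and those of the rows inserted so far.\<close>
  define A where "A = I0 \<union> \<sigma> ` J"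
  define k where "k = \<sigma> j"
  define Y where "Y \<omega> = (\<lambda>i\<in>A. X i \<omega>)" for \<omega>
  \<comment> \<open>The current rows as functions of the revealed values; row \<open>j\<close> is
    still the unit vector, as \<open>j \<notin> J\<close>.\<close>
  define G where "G y i = (if i \<in> J then y (\<sigma> i) - b (restrict y I0) else axis i 1)" for y i
  have "A \<subseteq> I" "k \<in> I" "k \<notin> A" "I0 \<subseteq> A"
    using insert.prems insert.hyps \<open>I0 \<subseteq> I\<close> unfolding A_def k_def by auto
  \<comment> \<open>A one-component tuple, because independence of disjoint blocks is stated for
    tuples.\<close>
  define Z where "Z \<omega> = (\<lambda>i\<in>{k}. X i \<omega>)" for \<omega>
  have Z_k: "Z \<omega> k = X k \<omega>" for \<omega>
    by (simp add: Z_def)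
  have indep: "indep_var (PiM A (\<lambda>_. borel)) Y (PiM {k} (\<lambda>_. borel)) Z"
    unfolding Y_def Z_def using \<open>A \<subseteq> I\<close> \<open>k \<in> I\<close> \<open>k \<notin> A\<close> by (intro indep_var_restrict[OF ind]) auto
  have bY [measurable]: "(\<lambda>y. b (restrict y I0)) \<in> borel_measurable (PiM A (\<lambda>_. borel))"
    using measurable_compose[OF measurable_restrict_subset[OF \<open>I0 \<subseteq> A\<close>] b] .
  have G [measurable]: "(\<lambda>y. G y i) \<in> borel_measurable (PiM A (\<lambda>_. borel))" for i
  proof (cases "i \<in> J")
    case True
    then have "(\<lambda>y. y (\<sigma> i)) \<in> borel_measurable (PiM A (\<lambda>_. borel))"
      by (intro measurable_component_singleton) (simp add: A_def)
    from borel_measurable_diff[OF this bY] True show ?thesis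
      by (simp add: G_def)
  qed (simp add: G_def)
  \<comment> \<open>Stated as an implication so that it can be checked for every fixed value
    \<open>y\<close>, including those where the old determinant vanishes.\<close>
  have "AE \<omega> in M. det (\<chi> i. G (Y \<omega>) i) \<noteq> 0 \<longrightarrow>
      det (\<chi> i. if i = j then Z \<omega> k - b (restrict (Y \<omega>) I0) else G (Y \<omega>) i) \<noteq> 0"
  proof (rule AE_indep_var_pair[OF indep])
    let ?N = "PiM A (\<lambda>_. borel) \<Otimes>\<^sub>M PiM {k} (\<lambda>_. borel :: (real ^ 'n) measure)"
    have [measurable]: "(\<lambda>w. snd w k) \<in> borel_measurable ?N"
      by (rule measurable_compose[OF measurable_snd measurable_component_singleton]) simp
    have [measurable]: "(\<lambda>w. det (\<chi> i. if i = j then snd w k - b (restrict (fst w) I0) else G (fst w) i))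
        \<in> borel_measurable ?N"
    proof (rule borel_measurable_det_rows)
      fix i
      show "(\<lambda>w. if i = j then snd w k - b (restrict (fst w) I0) else G (fst w) i) \<in> borel_measurable ?N"
        by (cases "i = j") (auto intro!: borel_measurable_diff measurable_compose[OF measurable_fst])
    qed
    have [measurable]: "(\<lambda>w. det (\<chi> i. G (fst w) i)) \<in> borel_measurable ?N"
      by (intro borel_measurable_det_rows) (auto intro!: measurable_compose[OF measurable_fst])
    show "{w \<in> space ?N. det (\<chi> i. G (fst w) i) \<noteq> 0 \<longrightarrow>
        det (\<chi> i. if i = j then snd w k - b (restrict (fst w) I0) else G (fst w) i) \<noteq> 0} \<in> sets ?N"
      by measurable
  next
    fix y
    have distr: "distr M borel (X k) = density lborel (f k)"
      using dens[OF \<open>k \<in> I\<close>] by (metis distributed_distr_eq_density distr_cong sets_lborel)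
    have "f k \<in> borel_measurable lborel"
      using dens[OF \<open>k \<in> I\<close>] by (rule distributed_borel_measurable)
    moreover have "AE z in lborel. det (\<chi> i. if i = j then z - b (restrict y I0) else G y i) \<noteq> 0"
      if "det (\<chi> i. G y i) \<noteq> 0"
    proof (rule AE_lborel_det_row_ne_0)
      \<comment> \<open>The unit vector being replaced witnesses that the determinant is a nonzero
        function of row \<open>j\<close>.\<close>
      have "(\<chi> i. if i = j then axis j 1 else G y i) = (\<chi> i. G y i)"
        using \<open>j \<notin> J\<close> by (simp add: vec_eq_iff G_def)
      with that show "det (\<chi> i. if i = j then axis j 1 else G y i) \<noteq> 0"
        by simp
    qed
    ultimately have ae: "AE z in distr M borel (X k). det (\<chi> i. G y i) \<noteq> 0 \<longrightarrow>
        det (\<chi> i. if i = j then z - b (restrict y I0) else G y i) \<noteq> 0"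
      unfolding distr
      by (cases "det (\<chi> i. G y i) = 0") (auto simp: AE_density elim: eventually_mono)
    have "X k \<in> borel_measurable M"
      using ind \<open>k \<in> I\<close> by (auto simp: indep_vars_def)
    from AE_distrD[OF this ae] show "AE \<omega> in M. det (\<chi> i. G y i) \<noteq> 0 \<longrightarrow>
        det (\<chi> i. if i = j then Z \<omega> k - b (restrict y I0) else G y i) \<noteq> 0"
      unfolding Z_k .
  qed
  moreover have "AE \<omega> in M. det (\<chi> i. if i \<in> J then X (\<sigma> i) \<omega> - b (\<lambda>i\<in>I0. X i \<omega>) else axis i 1) \<noteq> 0"
    using insert by auto
  ultimately show ?case
  proof eventually_elim
    case (elim \<omega>)
    have Y_I0: "restrict (Y \<omega>) I0 = (\<lambda>i\<in>I0. X i \<omega>)"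
      using \<open>I0 \<subseteq> A\<close> by (auto simp: Y_def restrict_def fun_eq_iff)
    have "Y \<omega> (\<sigma> i) = X (\<sigma> i) \<omega>" if "i \<in> J" for i
      using that by (simp add: Y_def A_def)
    then have G_Y: "G (Y \<omega>) = (\<lambda>i. if i \<in> J then X (\<sigma> i) \<omega> - b (\<lambda>i\<in>I0. X i \<omega>) else axis i 1)"
      by (intro ext) (simp add: G_def Y_I0)
    have rows: "(\<chi> i. if i = j then X k \<omega> - b (\<lambda>i\<in>I0. X i \<omega>)
          else if i \<in> J then X (\<sigma> i) \<omega> - b (\<lambda>i\<in>I0. X i \<omega>) else axis i 1)
        = (\<chi> i. if i \<in> insert j J then X (\<sigma> i) \<omega> - b (\<lambda>i\<in>I0. X i \<omega>) else axis i 1)"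
      by (simp add: vec_eq_iff k_def)
    from elim(1)[unfolded Y_I0 Z_k G_Y, rule_format, OF elim(2)] show ?case
      unfolding rows .
  qed
qed

text \<open>Two uses of the determinant result: a largest possible selection of vectors gives the
  rank, and a single inserted row gives nonvanishing coordinates.\<close>

lemma (in prob_space) AE_centred_generic:
  fixes X :: "nat \<Rightarrow> 'a \<Rightarrow> real ^ 'n"
  assumes ind: "indep_vars (\<lambda>_. borel) X I"
    and dens: "\<And>i. i \<in> I \<Longrightarrow> distributed M lborel (X i) (f i)"
    and b: "b \<in> borel_measurable (PiM I0 (\<lambda>_. borel))" and "I0 \<subseteq> I"
    and K: "finite K" "K \<noteq> {}" "K \<subseteq> I - I0"
  shows "AE \<omega> in M. dim ((\<lambda>k. X k \<omega> - b (\<lambda>i\<in>I0. X i \<omega>)) ` K) = min (card K) CARD('n) \<and>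
           (\<forall>i. \<exists>k\<in>K. (X k \<omega> - b (\<lambda>i\<in>I0. X i \<omega>)) $ i \<noteq> 0)"
proof -
  obtain J :: "'n set" where J: "card J = min (card K) CARD('n)"
    using obtain_subset_with_card_n[of "min (card K) CARD('n)" "UNIV :: 'n set"] by auto
  obtain K' where K': "K' \<subseteq> K" "card K' = min (card K) CARD('n)" "finite K'"
    using obtain_subset_with_card_n[of "min (card K) CARD('n)" K] by auto
  obtain \<sigma> where "bij_betw \<sigma> J K'"
    using finite_same_card_bij[of J K'] J K' by auto
  then have \<sigma>: "inj_on \<sigma> J" "\<sigma> ` J \<subseteq> K"
    using K' by (auto simp: bij_betw_def)
  obtain k where "k \<in> K"
    using K by blast
  have "AE \<omega> in M. det (\<chi> j. if j \<in> J then X (\<sigma> j) \<omega> - b (\<lambda>i\<in>I0. X i \<omega>) else axis j 1) \<noteq> 0"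
    using \<sigma> K by (intro AE_det_centred_rows_ne_0[OF ind dens b \<open>I0 \<subseteq> I\<close>]) auto
  moreover have "AE \<omega> in M. \<forall>i\<in>UNIV. det (\<chi> j. if j \<in> {i} then X k \<omega> - b (\<lambda>i\<in>I0. X i \<omega>) else axis j 1) \<noteq> 0"
    using K \<open>k \<in> K\<close>
    by (intro AE_finite_allI AE_det_centred_rows_ne_0[OF ind dens b \<open>I0 \<subseteq> I\<close>, where \<sigma> = "\<lambda>_. k"]) auto
  ultimately show ?thesis
  proof eventually_elim
    case (elim \<omega>)
    have "(X k \<omega> - b (\<lambda>i\<in>I0. X i \<omega>)) $ i \<noteq> 0" for i
    proof
      assume "(X k \<omega> - b (\<lambda>i\<in>I0. X i \<omega>)) $ i = 0"
      \<comment> \<open>The identity with row \<open>i\<close> replaced by a vector has that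
        vector's coordinate \<open>i\<close> as the only possibly nonzero entry of column
        \<open>i\<close>.\<close>
      then have "column i (\<chi> j. if j \<in> {i} then X k \<omega> - b (\<lambda>i\<in>I0. X i \<omega>) else axis j 1) = 0"
        by (simp add: vec_eq_iff column_def axis_def)
      from det_zero_column[OF this] elim(2) show False
        by blast
    qed
    with \<open>k \<in> K\<close> dim_family_eq_min[OF K(1) \<sigma>(2) J, of "\<lambda>k. X k \<omega> - b (\<lambda>i\<in>I0. X i \<omega>)"] elim(1)
    show ?case
      by blast
  qed
qed

section \<open>Rank and diagonal of the sample covariance matrices, and the conclusion\<close>

lemma scatter_about_rank_and_diag:
  fixes x :: "nat \<Rightarrow> real ^ 'n" and y :: "'i \<Rightarrow> real ^ 'n"
  assumes n: "1 \<le> n"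
    and ker: "\<And>v. (\<forall>k\<in>{1..n}. (x k - c) \<bullet> v = 0) \<longleftrightarrow> (\<forall>k\<in>K. y k \<bullet> v = 0)"
    and dim: "dim (y ` K) = min (card K) CARD('n)"
    and diag: "\<And>i. \<exists>k\<in>K. y k $ i \<noteq> 0"
  shows "eigenvalue_count (scatter_about c n x) 0 = CARD('n) - card K"
    and "0 < scatter_about c n x $ i $ i"
proof -
  have "transpose (scatter_about c n x) = scatter_about c n x"
    using pos_semidef_scatter_about by (auto simp: pos_semidef_def)
  then have "eigenvalue_count (scatter_about c n x) 0 = dim {v. \<forall>k\<in>K. y k \<bullet> v = 0}"
    by (simp only: eigenvalue_count_0_eq_dim_ker scatter_about_ker[OF n] ker)
  \<comment> \<open>Truncated subtraction absorbs the minimum: once \<open>card K\<close> reaches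
    the dimension, both sides are 0.\<close>
  then show "eigenvalue_count (scatter_about c n x) 0 = CARD('n) - card K"
    using dim_orthogonal_to_family[of K y] dim by linarith
  have "\<not> (\<forall>k\<in>K. y k \<bullet> axis i 1 = 0)"
    using diag[of i] by (simp add: inner_axis)
  then have "scatter_about c n x $ i $ i \<noteq> 0"
    using scatter_about_quadratic_form_eq_0_iff[OF n, of "axis i 1" c x] ker by simp
  with pos_semidef_diag_nonneg[OF pos_semidef_scatter_about, of c n x i]
  show "0 < scatter_about c n x $ i $ i"
    by simp
qed

text \<open>Centring at the first observation leaves the \<open>n - 1\<close> differences with index
  set \<open>{2..n}\<close>, nonempty because \<open>2 \<le> n\<close>.\<close>

lemma (in prob_space) AE_sample_cov_unknown_mean:
  fixes X :: "nat \<Rightarrow> 'a \<Rightarrow> real ^ 'n"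
  assumes n: "2 \<le> n" and ind: "indep_vars (\<lambda>_. borel) X {1..n}"
    and dens: "\<And>i. i \<in> {1..n} \<Longrightarrow> distributed M lborel (X i) (f i)"
  shows "AE \<omega> in M. eigenvalue_count (sample_cov_unknown_mean n (\<lambda>k. X k \<omega>)) 0 = CARD('n) + 1 - n \<and>
           (\<forall>i. 0 < sample_cov_unknown_mean n (\<lambda>k. X k \<omega>) $ i $ i)"
proof -
  have K: "finite {2..n}" "{2..n} \<noteq> {}" "{2..n} \<subseteq> {1..n} - {1}" "{1} \<subseteq> {1..n}"
    using n by auto
  have b: "(\<lambda>z. z 1) \<in> borel_measurable (PiM {1} (\<lambda>_. borel :: (real ^ 'n) measure))"
    by (rule measurable_component_singleton) simp
  have "AE \<omega> in M. dim ((\<lambda>k. X k \<omega> - (\<lambda>i\<in>{1}. X i \<omega>) 1) ` {2..n}) = min (card {2..n}) CARD('n) \<and>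
           (\<forall>i. \<exists>k\<in>{2..n}. (X k \<omega> - (\<lambda>i\<in>{1}. X i \<omega>) 1) $ i \<noteq> 0)"
    by (rule AE_centred_generic[OF ind dens b K(4) K(1-3)])
  then show ?thesis
  proof eventually_elim
    case (elim \<omega>)
    have 1: "1 \<le> n" and card: "CARD('n) + 1 - n = CARD('n) - card {2..n}"
      using n by simp_all
    from elim have gen: "dim ((\<lambda>k. X k \<omega> - X 1 \<omega>) ` {2..n}) = min (card {2..n}) CARD('n)"
      "\<And>i. \<exists>k\<in>{2..n}. (X k \<omega> - X 1 \<omega>) $ i \<noteq> 0"
      by simp_all
    show ?case
      unfolding sample_cov_unknown_mean_def card
      using scatter_about_rank_and_diag[OF 1 centred_inner_eq_0_iff[OF 1] gen] by blast
  qed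
qed

text \<open>Here the centre is constant, so it depends on the empty index set and all
  \<open>n\<close> observations count.\<close>

lemma (in prob_space) AE_sample_cov_known_mean:
  fixes X :: "nat \<Rightarrow> 'a \<Rightarrow> real ^ 'n"
  assumes n: "1 \<le> n" and ind: "indep_vars (\<lambda>_. borel) X {1..n}"
    and dens: "\<And>i. i \<in> {1..n} \<Longrightarrow> distributed M lborel (X i) (f i)"
  shows "AE \<omega> in M. eigenvalue_count (sample_cov_known_mean \<mu> n (\<lambda>k. X k \<omega>)) 0 = CARD('n) - n \<and>
           (\<forall>i. 0 < sample_cov_known_mean \<mu> n (\<lambda>k. X k \<omega>) $ i $ i)"
proof -
  have K: "finite {1..n}" "{1..n} \<noteq> {}" "{1..n} \<subseteq> {1..n} - {}" "{} \<subseteq> {1..n}"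
    using n by auto
  have "AE \<omega> in M. dim ((\<lambda>k. X k \<omega> - \<mu>) ` {1..n}) = min (card {1..n}) CARD('n) \<and>
           (\<forall>i. \<exists>k\<in>{1..n}. (X k \<omega> - \<mu>) $ i \<noteq> 0)"
    by (rule AE_centred_generic[OF ind dens borel_measurable_const K(4) K(1-3)])
  then show ?thesis
  proof eventually_elim
    case (elim \<omega>)
    have card: "CARD('n) - n = CARD('n) - card {1..n}"
      by simp
    show ?case
      unfolding sample_cov_known_mean_def card
      using scatter_about_rank_and_diag[OF n refl elim[THEN conjunct1] elim[THEN conjunct2, rule_format]]
      by blast
  qed
qed

text \<open>A constant \<open>K\<close> strictly between \<open>m\<close> and the lower limit keeps
  the slack \<open>K - m\<close> on which coercivity rests.\<close>

lemma Liminf_ratio_ln_growth: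
  fixes pen :: "real \<Rightarrow> real"
  assumes "ereal m < Liminf at_infinity (\<lambda>x. ereal (pen x / ln \<bar>x\<bar>))"
  obtains K R where "m < K" "\<And>x. R \<le> x \<Longrightarrow> K * ln x \<le> pen x"
proof -
  obtain K where K: "ereal m < ereal K" "ereal K < Liminf at_infinity (\<lambda>x. ereal (pen x / ln \<bar>x\<bar>))"
    using ereal_dense2[OF assms] by blast
  from less_LiminfD[OF K(2)] obtain R where R: "\<And>x. R \<le> norm x \<Longrightarrow> ereal K < ereal (pen x / ln \<bar>x\<bar>)"
    by (auto simp: eventually_at_infinity)
  show thesis
  proof (rule that)
    show "m < K"
      using K by simp
    \<comment> \<open>Starting at 2 makes \<open>ln x\<close> positive, so the quotient can be
      cleared.\<close>
    fix x assume "max R 2 \<le> x"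
    then have "K < pen x / ln x" "0 < ln x"
      using R[of x] by auto
    then show "K * ln x \<le> pen x"
      by (simp add: pos_less_divide_eq)
  qed
qed

theorem corollary3:
  fixes M :: "'w measure"
    and X :: "nat \<Rightarrow> 'w \<Rightarrow> real ^ ('p::{finite,linorder})"
    and \<mu> :: "real ^ ('p::{finite,linorder})"
    and \<Theta>\<^sub>0 :: "real ^ ('p::{finite,linorder}) ^ ('p::{finite,linorder})"
    and S :: "'w \<Rightarrow> real ^ ('p::{finite,linorder}) ^ ('p::{finite,linorder})"
    and pen pen\<^sub>D :: "real \<Rightarrow> real"
    and n m\<^sub>0 :: nat
  assumes pen_nonneg: "\<And>x. pen x \<ge> 0"
    and pen_sym: "\<And>x. pen (- x) = pen x"
    and pen_mono: "\<And>x y. \<bar>x\<bar> \<le> \<bar>y\<bar> \<Longrightarrow> pen x \<le> pen y"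
    and pen_cont: "continuous_on UNIV pen"
    and pen_D_zero: "\<And>x. x > 0 \<Longrightarrow> pen\<^sub>D x = 0"
    and prob: "prob_space M"
    and n: "n \<ge> 1"
    and \<Theta>\<^sub>0: "pos_def \<Theta>\<^sub>0"
    and X: "iid_gaussian M n X \<mu> (matrix_inv \<Theta>\<^sub>0)"
    and S: "(S = (\<lambda>\<omega>. sample_cov_unknown_mean n (\<lambda>k. X k \<omega>)) \<and> m\<^sub>0 = CARD('p) + 1 - n) \<or>
            (S = (\<lambda>\<omega>. sample_cov_known_mean \<mu> n (\<lambda>k. X k \<omega>)) \<and> m\<^sub>0 = CARD('p) - n)"
    and m\<^sub>0: "m\<^sub>0 < CARD('p)"
    and pen_growth: "Liminf at_infinity (\<lambda>x. ereal (pen x / ln \<bar>x\<bar>)) > ereal (real m\<^sub>0)"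
  shows "AE \<omega> in M. eigenvalue_count (S \<omega>) 0 = m\<^sub>0 \<and> penalised_estimate_exists pen\<^sub>D pen (S \<omega>)"
proof -
  interpret prob_space M by (rule prob)
  have ind: "indep_vars (\<lambda>_. borel) X {1..n}"
    and dens: "\<And>i. i \<in> {1..n} \<Longrightarrow>
      distributed M lborel (X i) (\<lambda>x. ennreal (mvn_density \<mu> (matrix_inv \<Theta>\<^sub>0) x))"
    using X by (auto simp: iid_gaussian_def)
  obtain K R where K: "real m\<^sub>0 < K" and growth: "\<And>x. R \<le> x \<Longrightarrow> K * ln x \<le> pen x"
    using Liminf_ratio_ln_growth[OF pen_growth] by blast
  have psd: "pos_semidef (S \<omega>)" for \<omega>
    using S by (auto simp: sample_cov_unknown_mean_def sample_cov_known_mean_def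
        pos_semidef_scatter_about)
  have "AE \<omega> in M. eigenvalue_count (S \<omega>) 0 = m\<^sub>0 \<and> (\<forall>i. 0 < S \<omega> $ i $ i)"
    using S
  proof (elim disjE conjE)
    assume S: "S = (\<lambda>\<omega>. sample_cov_unknown_mean n (\<lambda>k. X k \<omega>))" and m: "m\<^sub>0 = CARD('p) + 1 - n"
    \<comment> \<open>A single observation with unknown mean would give
      \<open>m\<^sub>0 = CARD('p)\<close>, which is excluded.\<close>
    from m m\<^sub>0 have "2 \<le> n"
      by simp
    then show ?thesis
      unfolding S m by (rule AE_sample_cov_unknown_mean[OF _ ind dens])
  next
    assume S: "S = (\<lambda>\<omega>. sample_cov_known_mean \<mu> n (\<lambda>k. X k \<omega>))" and m: "m\<^sub>0 = CARD('p) - n"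
    show ?thesis
      unfolding S m by (rule AE_sample_cov_known_mean[OF n ind dens])
  qed
  then show ?thesis
  proof eventually_elim
    case (elim \<omega>)
    with K have "real (eigenvalue_count (S \<omega>) 0) < K"
      by simp
    then have "penalised_estimate_exists pen\<^sub>D pen (S \<omega>)"
      using elim
      by (intro penalised_estimate_existsI[OF pen_nonneg pen_mono pen_cont pen_D_zero growth _ psd]) auto
    with elim show ?case
      by blast
  qed
qed

end
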